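(* Let $G$ be a finite abelian group with $b\ge 2$ elements, let $s,m\ge 1$ and $n\ge m$ be integers, and let $P\subset \mathbb{X}_n^s$ be a subgroup of cardinality $b^m$. Then, for every integer $0\le t\le m$, $P$ is a (combinatorial) $(t,m,s)$-net in base $b$ if and only if $\mathrm{minNRT}(P^\perp)\ge m-t+1$. In other words, $P$ is a strict $(t,m,s)$-net with $t=m+1-\mathrm{minNRT}(P^\perp)$.
   Context: $\mathbb{X}_n:=G^n$, and $\mathbb{X}_n^s$ is identified with the additive group of $s\times n$ matrices $X=(\xi_{i,j})$ over $G$. $T=\{z\in\mathbb{C}:|z|=1\}$; $G^*=\mathrm{Hom}(G,T)$ is the dual (character) group, written additively, so $0\in G^*$ is the trivial character. $\mathbb{K}_n:=(G^* )^n$, and $\mathbb{K}_n^s$ is identified with the $s\times n$ matrices $K=(\kappa_{i,j})$ over $G^*$. Pairing: $K\bullet X:=\prod_{i,j}\kappa_{i,j}(\xi_{i,j})\in T$. For a subgroup $P\subset\mathbb{X}_n^s$, $P^\perp:=\{K\in\mathbb{K}_n^s: K\bullet X=1 \text{ for all } X\in P\}$. NRT weight: for $k=(\kappa_1,\ldots,\kappa_n)\in\mathbb{K}_n$, $\mu(k)=\max\{j:\kappa_j\ne 0\}$ if $k\neq 0$ and $\mu(0)=0$; for $K\in\mathbb{K}_n^s$ with rows $k_1,\ldots,k_s$, $\mu(K)=\sum_{i=1}^s\mu(k_i)$. For a subgroup $Q\subset\mathbb{K}_n^s$, $\mathrm{minNRT}(Q)=\min\{\mu(K):K\in Q,K\ne0\}$,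 and $\mathrm{minNRT}(\{0\})=ns+1$. Nets: a set of $b^m$ points in $[0,1)^s$ is a $(t,m,s)$-net in base $b$ ($0\le t\le m$ an integer) if for all integers $d_1,\ldots,d_s\ge0$ with $d_1+\cdots+d_s=m-t$ and all integers $0\le a_i<b^{d_i}$, the interval $\prod_{i=1}^s[a_i b^{-d_i},(a_i+1)b^{-d_i})$ contains exactly $b^t$ of the points. Fix a bijection $\varphi:\{0,\ldots,b-1\}\to G$ with $\varphi(0)=0$; it induces the injection $\varphi^{-1}:\mathbb{X}_n^s\to[0,1)^s$ sending $X$ to the point with $i$-th coordinate $\sum_{j=1}^n\varphi^{-1}(\xi_{i,j})b^{-j}$. A subset $P\subset\mathbb{X}_n^s$ is a (combinatorial) $(t,m,s)$-net in base $b$ if $\varphi^{-1}(P)$ is a $(t,m,s)$-net in base $b$; it is strict (and $t$ is its exact $t$-value) if $t$ is the smallest value for which this holds. *)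

theory Defs
  imports Complex_Main "HOL-Algebra.Product_Groups"
begin

text \<open>
  Abelian groups are \<open>comm_group\<close> structures in multiplicative notation, so the element
  written \<open>0\<close> on paper is the unit \<open>\<one>\<close>. Products are the library's
  \<open>product_group\<close>, whose elements are extensional functions.
\<close>

definition circle_group :: "complex monoid" where
  "circle_group = \<lparr>carrier = {z. cmod z = 1}, monoid.mult = (*), one = 1\<rparr>"

text \<open>
  A character is represented by a function that is \<open>undefined\<close> outside \<open>carrier G\<close>, so that
  equality of characters is equality of functions.
\<close>

definition dual_group :: "('a, 'c) monoid_scheme \<Rightarrow> ('a \<Rightarrow> complex) monoid" where
  "dual_group G =
     \<lparr>carrier = hom G circle_group \<inter> extensional (carrier G),
      monoid.mult = (\<lambda>\<chi> \<psi>. \<lambda>x\<in>carrier G. \<chi> x * \<psi> x),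
      one = (\<lambda>x\<in>carrier G. 1)\<rparr>"

definition row_group :: "('a, 'c) monoid_scheme \<Rightarrow> nat \<Rightarrow> (nat \<Rightarrow> 'a) monoid" where
  "row_group G n = product_group {1..n} (\<lambda>_. G)"

text \<open>
  The group of \<open>s \<times> n\<close> matrices over \<open>G\<close>; the entry in row \<open>i \<in> {1..s}\<close> and column
  \<open>j \<in> {1..n}\<close> of \<open>X\<close> is \<open>X i j\<close>, and \<open>X i\<close> is the \<open>i\<close>-th row.
\<close>

definition matrix_group ::
    "('a, 'c) monoid_scheme \<Rightarrow> nat \<Rightarrow> nat \<Rightarrow> (nat \<Rightarrow> nat \<Rightarrow> 'a) monoid" where
  "matrix_group G s n = product_group {1..s} (\<lambda>_. row_group G n)"

definition pairing ::
    "nat \<Rightarrow> nat \<Rightarrow> (nat \<Rightarrow> nat \<Rightarrow> 'a \<Rightarrow> complex) \<Rightarrow> (nat \<Rightarrow> nat \<Rightarrow> 'a) \<Rightarrow> complex" where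
  "pairing s n K X = (\<Prod>i\<in>{1..s}. \<Prod>j\<in>{1..n}. K i j (X i j))"

definition perp ::
    "('a, 'c) monoid_scheme \<Rightarrow> nat \<Rightarrow> nat \<Rightarrow> (nat \<Rightarrow> nat \<Rightarrow> 'a) set
      \<Rightarrow> (nat \<Rightarrow> nat \<Rightarrow> 'a \<Rightarrow> complex) set" where
  "perp G s n P =
     {K \<in> carrier (matrix_group (dual_group G) s n). \<forall>X\<in>P. pairing s n K X = 1}"

definition row_weight ::
    "('a, 'c) monoid_scheme \<Rightarrow> nat \<Rightarrow> (nat \<Rightarrow> 'a \<Rightarrow> complex) \<Rightarrow> nat" where
  "row_weight G n k =
     (if k = \<one>\<^bsub>row_group (dual_group G) n\<^esub> then 0
      else Max {j \<in> {1..n}. k j \<noteq> \<one>\<^bsub>dual_group G\<^esub>})"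

definition NRT_weight ::
    "('a, 'c) monoid_scheme \<Rightarrow> nat \<Rightarrow> nat \<Rightarrow> (nat \<Rightarrow> nat \<Rightarrow> 'a \<Rightarrow> complex) \<Rightarrow> nat" where
  "NRT_weight G s n K = (\<Sum>i\<in>{1..s}. row_weight G n (K i))"

definition minNRT ::
    "('a, 'c) monoid_scheme \<Rightarrow> nat \<Rightarrow> nat \<Rightarrow> (nat \<Rightarrow> nat \<Rightarrow> 'a \<Rightarrow> complex) set \<Rightarrow> nat" where
  "minNRT G s n Q =
     (if Q = {\<one>\<^bsub>matrix_group (dual_group G) s n\<^esub>} then n * s + 1
      else Min {NRT_weight G s n K | K. K \<in> Q \<and> K \<noteq> \<one>\<^bsub>matrix_group (dual_group G) s n\<^esub>})"

text \<open>A point of \<open>[0,1)\<^sup>s\<close> is an extensional function on \<open>{1..s}\<close>.\<close>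

definition is_net :: "nat \<Rightarrow> nat \<Rightarrow> nat \<Rightarrow> nat \<Rightarrow> (nat \<Rightarrow> real) set \<Rightarrow> bool" where
  "is_net t m s b S \<longleftrightarrow>
     t \<le> m \<and> S \<subseteq> (\<Pi>\<^sub>E i\<in>{1..s}. {0..<1}) \<and> card S = b ^ m \<and>
     (\<forall>d a :: nat \<Rightarrow> nat.
        (\<Sum>i\<in>{1..s}. d i) = m - t \<and> (\<forall>i\<in>{1..s}. a i < b ^ d i) \<longrightarrow>
        card (S \<inter> (\<Pi>\<^sub>E i\<in>{1..s}. {real (a i) / real b ^ d i ..< (real (a i) + 1) / real b ^ d i}))
          = b ^ t)"

definition point_of_matrix ::
    "(nat \<Rightarrow> 'a) \<Rightarrow> nat \<Rightarrow> nat \<Rightarrow> nat \<Rightarrow> (nat \<Rightarrow> nat \<Rightarrow> 'a) \<Rightarrow> (nat \<Rightarrow> real)" where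
  "point_of_matrix \<phi> b s n X =
     (\<lambda>i\<in>{1..s}. \<Sum>j\<in>{1..n}. real (inv_into {0..<b} \<phi> (X i j)) / real b ^ j)"

definition is_comb_net ::
    "(nat \<Rightarrow> 'a) \<Rightarrow> nat \<Rightarrow> nat \<Rightarrow> nat \<Rightarrow> nat \<Rightarrow> nat \<Rightarrow> (nat \<Rightarrow> nat \<Rightarrow> 'a) set \<Rightarrow> bool" where
  "is_comb_net \<phi> n t m s b P \<longleftrightarrow> is_net t m s b (point_of_matrix \<phi> b s n ` P)"

definition is_strict_comb_net ::
    "(nat \<Rightarrow> 'a) \<Rightarrow> nat \<Rightarrow> nat \<Rightarrow> nat \<Rightarrow> nat \<Rightarrow> nat \<Rightarrow> (nat \<Rightarrow> nat \<Rightarrow> 'a) set \<Rightarrow> bool" where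
  "is_strict_comb_net \<phi> n t m s b P \<longleftrightarrow>
     is_comb_net \<phi> n t m s b P \<and> (\<forall>t'<t. \<not> is_comb_net \<phi> n t' m s b P)"

end

theory Submission
  imports Defs "HOL-Algebra.Multiplicative_Group"
begin

text \<open>
  Two matrices lie in the same elementary interval of shape \<open>(d\<^sub>1, \<dots>, d\<^sub>s)\<close> iff they agree in
  the first \<open>d\<^sub>i\<close> entries of every row \<open>i\<close>. For a subgroup \<open>P\<close> the nonempty fibres of the
  restriction to these positions are cosets of one subgroup, so \<open>P\<close> is a \<open>(t, m, s)\<close>-net iff the
  restriction is onto for all \<open>d\<close> with \<open>d\<^sub>1 + \<dots> + d\<^sub>s = m - t\<close>. A subgroup of a finite abelian
  group is proper iff a nontrivial character vanishes on it; so ontoness means that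
  no nontrivial element of \<open>P\<^sup>\<bottom>\<close> is supported on these positions, and being supported on such
  positions for some \<open>d\<close> is the same as having NRT weight at most \<open>m - t\<close>.
\<close>

section \<open>Characters separate points from subgroups\<close>

text \<open>The equivalence for \<open>t \<le> m\<close> does not by itself give the exact t-value:
  m + 1 - minNRT must also lie between 0 and m. The upper end is the positivity of nontrivial
  weights. The lower end, minNRT at most m + 1, is a pigeonhole statement. Its obstacle is that a
  shape of size m + 1 with no row longer than n may not exist; this happens only if the whole matrix
  has just m positions, and there the conventional value n*s + 1 for the trivial annihilator is
  exactly m + 1. Separation by characters rests on divisibility of the circle: every value has an
  r-th root in it, so a character of a subgroup extends one generator at a time. It is applied to
  the matrix group as a whole, and the resulting character is then split into its entries.\<close>

lemma comm_group_circle_group: "comm_group circle_group"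
proof (rule comm_groupI)
  show "\<exists>y\<in>carrier circle_group. y \<otimes>\<^bsub>circle_group\<^esub> x = \<one>\<^bsub>circle_group\<^esub>"
    if "x \<in> carrier circle_group" for x
    using that by (intro bexI[of _ "inverse x"]) (auto simp: circle_group_def norm_inverse intro!: left_inverse)
qed (auto simp: circle_group_def norm_mult)

text \<open>This is the subgroup generated by \<open>H\<close> and \<open>p\<close>. It serves below
  for graphs of characters, with \<open>p\<close> a new argument-value pair.\<close>

lemma (in comm_group) subgroup_mult_int_powers:
  assumes H: "subgroup H G" and p: "p \<in> carrier G"
  shows "subgroup {g \<otimes> p [^] (k::int) | g k. g \<in> H} G"
proof (rule group.subgroupI)
  show "group G" by (rule is_group)
  show "{g \<otimes> p [^] (k::int) | g k. g \<in> H} \<subseteq> carrier G"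
    using subgroup.mem_carrier[OF H] p by auto
  show "{g \<otimes> p [^] (k::int) | g k. g \<in> H} \<noteq> {}"
    using subgroup.one_closed[OF H] by auto
next
  fix a assume "a \<in> {g \<otimes> p [^] (k::int) | g k. g \<in> H}"
  then obtain g and k :: int where a: "a = g \<otimes> p [^] k" "g \<in> H" by auto
  have "inv a = inv g \<otimes> p [^] (- k)"
    using a p subgroup.mem_carrier[OF H] by (simp add: inv_mult int_pow_neg)
  then show "inv a \<in> {g \<otimes> p [^] (k::int) | g k. g \<in> H}"
    using subgroup.m_inv_closed[OF H a(2)] by blast
next
  fix a c assume "a \<in> {g \<otimes> p [^] (k::int) | g k. g \<in> H}" "c \<in> {g \<otimes> p [^] (k::int) | g k. g \<in> H}"
  then obtain g h and k l :: int
    where a: "a = g \<otimes> p [^] k" "g \<in> H" and c: "c = h \<otimes> p [^] l" "h \<in> H" by auto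
  have "a \<otimes> c = (g \<otimes> h) \<otimes> p [^] (k + l)"
    using a c p subgroup.mem_carrier[OF H] by (simp add: int_pow_mult m_ac)
  then show "a \<otimes> c \<in> {g \<otimes> p [^] (k::int) | g k. g \<in> H}"
    using subgroup.m_closed[OF H a(2) c(2)] by blast
qed

lemma (in comm_group) inv_mult_cancel_middle:
  assumes "g \<in> carrier G" "q \<in> carrier G" "u \<in> carrier G"
  shows "(inv g \<otimes> q) \<otimes> (g \<otimes> u) = q \<otimes> u"
proof -
  have "(inv g \<otimes> q) \<otimes> (g \<otimes> u) = (inv g \<otimes> g) \<otimes> (q \<otimes> u)"
    using assms by (simp only: m_ac inv_closed m_closed)
  then show ?thesis using assms by simp
qed

text \<open>
  A character defined on a subgroup of \<open>M\<close> is encoded by its graph, so that extending it by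
  one element needs no choice of representatives.
\<close>

definition partial_character :: "('a, 'c) monoid_scheme \<Rightarrow> ('a \<times> complex) set \<Rightarrow> bool" where
  "partial_character M \<Gamma> \<longleftrightarrow>
     subgroup \<Gamma> (M \<times>\<times> circle_group) \<and> (\<forall>z. (\<one>\<^bsub>M\<^esub>, z) \<in> \<Gamma> \<longrightarrow> z = 1)"

context comm_group
begin

lemma comm_group_DirProd_circle: "comm_group (G \<times>\<times> circle_group)"
proof -
  interpret T: comm_group circle_group by (rule comm_group_circle_group)
  show ?thesis
    by (rule group.group_comm_groupI[OF DirProd_group[OF is_group T.is_group]])
      (auto simp: m_comm T.m_comm)
qed

lemma DirProd_circle_pow:
  assumes "x \<in> carrier G" "cmod w = 1"
  shows "(x, w) [^]\<^bsub>G \<times>\<times> circle_group\<^esub> (k::nat) = (x [^] k, w ^ k)"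
  by (induction k) (auto simp: circle_group_def DirProd_def mult.commute)

lemma fst_DirProd_circle_int_pow:
  assumes "p \<in> carrier (G \<times>\<times> circle_group)"
  shows "fst (p [^]\<^bsub>G \<times>\<times> circle_group\<^esub> (k::int)) = fst p [^] k"
proof -
  interpret C: comm_group "G \<times>\<times> circle_group" by (rule comm_group_DirProd_circle)
  have "fst \<in> hom (G \<times>\<times> circle_group) G" by (auto simp: hom_def)
  from hom_int_pow[OF this assms C.is_group is_group] show ?thesis .
qed

text \<open>The new graph is generated by \<open>\<Gamma>\<close> and the pair
  \<open>(y, w)\<close>. Only its fibre over the unit can go wrong: if a product of an element of
  \<open>\<Gamma>\<close> with the k-th power of the pair lies over the unit, then the k-th power of
  \<open>y\<close> is in the old domain, so minimality of \<open>r\<close> makes k a multiple of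
  \<open>r\<close>, and the k-th power of the pair was already in \<open>\<Gamma>\<close>.\<close>

lemma partial_character_extend:
  assumes \<Gamma>: "partial_character G \<Gamma>" and y: "y \<in> carrier G" and w: "cmod w = 1"
    and r: "0 < (r::nat)" "(y [^] r, w ^ r) \<in> \<Gamma>"
    and least: "\<And>k. 0 < k \<Longrightarrow> k < r \<Longrightarrow> y [^] k \<notin> fst ` \<Gamma>"
  shows "\<exists>\<Gamma>'. partial_character G \<Gamma>' \<and> \<Gamma> \<subseteq> \<Gamma>' \<and> (y, w) \<in> \<Gamma>'"
proof -
  let ?C = "G \<times>\<times> circle_group"
  interpret C: comm_group ?C by (rule comm_group_DirProd_circle)
  have sub: "subgroup \<Gamma> ?C" and one: "\<And>z. (\<one>, z) \<in> \<Gamma> \<Longrightarrow> z = 1"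
    using \<Gamma> by (auto simp: partial_character_def)
  define p where "p = (y, w)"
  have p: "p \<in> carrier ?C" using y w by (auto simp: p_def circle_group_def)
  let ?D = "{g \<otimes>\<^bsub>?C\<^esub> p [^]\<^bsub>?C\<^esub> (k::int) | g k. g \<in> \<Gamma>}"
  have pr: "p [^]\<^bsub>?C\<^esub> int r \<in> \<Gamma>"
    using r y w by (simp add: p_def DirProd_circle_pow int_pow_int)
  have prq: "p [^]\<^bsub>?C\<^esub> (int r * q) \<in> \<Gamma>" for q
    using C.subgroup_int_pow_closed[OF sub pr] p by (simp add: C.int_pow_pow)
  have "\<Gamma> \<subseteq> ?D"
  proof
    fix g assume "g \<in> \<Gamma>"
    moreover from this have "g = g \<otimes>\<^bsub>?C\<^esub> p [^]\<^bsub>?C\<^esub> (0::int)"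
      using subgroup.mem_carrier[OF sub] by (simp del: one_DirProd)
    ultimately show "g \<in> ?D" by blast
  qed
  moreover have "(y, w) \<in> ?D"
  proof -
    have "p = \<one>\<^bsub>?C\<^esub> \<otimes>\<^bsub>?C\<^esub> p [^]\<^bsub>?C\<^esub> (1::int)"
      using p by (simp del: one_DirProd)
    then show ?thesis using subgroup.one_closed[OF sub] unfolding p_def[symmetric] by blast
  qed
  moreover have "z = 1" if zD: "(\<one>, z) \<in> ?D" for z
  proof -
    obtain g and k :: int where g: "g \<in> \<Gamma>" and eq: "(\<one>, z) = g \<otimes>\<^bsub>?C\<^esub> p [^]\<^bsub>?C\<^esub> k"
      using zD by (elim CollectE exE conjE) (rule that)
    \<comment> \<open>Division of \<open>k\<close> by \<open>r\<close> with remainder: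
      \<open>?h\<close> is an element of \<open>\<Gamma>\<close> lying over the \<open>l\<close>-th
      power of \<open>y\<close>, which minimality of \<open>r\<close> allows only for
      \<open>l = 0\<close>.\<close>
    define l where "l = nat (k mod int r)"
    have l: "k = int r * (k div int r) + int l" "l < r"
      using r(1) by (auto simp: l_def nat_less_iff)
    let ?h = "inv\<^bsub>?C\<^esub> g \<otimes>\<^bsub>?C\<^esub> p [^]\<^bsub>?C\<^esub> (int r * - (k div int r))"
    have h: "?h \<in> \<Gamma>"
      using subgroup.m_closed[OF sub subgroup.m_inv_closed[OF sub g] prq] .
    have gc: "g \<in> carrier ?C" using subgroup.mem_carrier[OF sub g] .
    have "?h \<otimes>\<^bsub>?C\<^esub> (\<one>, z) = p [^]\<^bsub>?C\<^esub> (int r * - (k div int r)) \<otimes>\<^bsub>?C\<^esub> p [^]\<^bsub>?C\<^esub> k"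
      unfolding eq by (rule C.inv_mult_cancel_middle[OF gc C.int_pow_closed[OF p] C.int_pow_closed[OF p]])
    also have "\<dots> = p [^]\<^bsub>?C\<^esub> (int r * - (k div int r) + k)"
      by (rule C.int_pow_mult[OF p, symmetric])
    also have "int r * - (k div int r) + k = int l"
      using l(1) by simp
    finally have "fst (?h \<otimes>\<^bsub>?C\<^esub> (\<one>, z)) = y [^] l"
      using fst_DirProd_circle_int_pow[OF p, of "int l"] by (simp add: p_def int_pow_int)
    moreover have "fst (?h \<otimes>\<^bsub>?C\<^esub> (\<one>, z)) = fst ?h"
      using subgroup.mem_carrier[OF sub h] by (auto simp: mult_DirProd')
    ultimately have "y [^] l \<in> fst ` \<Gamma>" using h by (metis imageI)
    then have "l = 0" using least[of l] l(2) by blast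
    then have "k = int r * (k div int r)" using l(1) by simp
    then have "p [^]\<^bsub>?C\<^esub> k \<in> \<Gamma>" using prq by metis
    then have "(\<one>, z) \<in> \<Gamma>" using eq g subgroup.m_closed[OF sub] by simp
    then show ?thesis by (rule one)
  qed
  ultimately show ?thesis
    using C.subgroup_mult_int_powers[OF sub p] unfolding partial_character_def by blast
qed

text \<open>The quotient of two pairs with the same argument lies over the unit, where only the
  value 1 is allowed.\<close>

lemma partial_character_functional:
  assumes \<Gamma>: "partial_character G \<Gamma>" and "(x, z) \<in> \<Gamma>" "(x, z') \<in> \<Gamma>"
  shows "z = z'"
proof -
  let ?C = "G \<times>\<times> circle_group"
  interpret C: comm_group ?C by (rule comm_group_DirProd_circle)
  interpret T: comm_group circle_group by (rule comm_group_circle_group)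
  have sub: "subgroup \<Gamma> ?C" and one: "\<And>z. (\<one>, z) \<in> \<Gamma> \<Longrightarrow> z = 1"
    using \<Gamma> by (auto simp: partial_character_def)
  have c: "x \<in> carrier G" "z \<in> carrier circle_group" "z' \<in> carrier circle_group"
    using subgroup.mem_carrier[OF sub] assms by auto
  have "(x, z) \<otimes>\<^bsub>?C\<^esub> inv\<^bsub>?C\<^esub> (x, z') \<in> \<Gamma>"
    using assms sub by (simp add: subgroup.m_closed subgroup.m_inv_closed)
  then have "(\<one>, z \<otimes>\<^bsub>circle_group\<^esub> inv\<^bsub>circle_group\<^esub> z') \<in> \<Gamma>"
    using c by (simp add: inv_DirProd is_group T.is_group)
  then have "z \<otimes>\<^bsub>circle_group\<^esub> inv\<^bsub>circle_group\<^esub> z' = \<one>\<^bsub>circle_group\<^esub>"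
    using one by (simp add: circle_group_def)
  then show ?thesis using c by (metis T.inv_equality T.inv_closed T.inv_inv)
qed

lemma finite_exists_least_power:
  assumes "finite (carrier G)" "y \<in> carrier G" "\<one> \<in> A"
  obtains r :: nat where "0 < r" "y [^] r \<in> A" "\<And>k. 0 < k \<Longrightarrow> k < r \<Longrightarrow> y [^] k \<notin> A"
proof -
  have "0 < order G \<and> y [^] order G \<in> A"
    using assms by (simp add: pow_order_eq_1 order_gt_0_iff_finite)
  from LeastI[of "\<lambda>k. 0 < k \<and> y [^] k \<in> A", OF this] not_less_Least[of _ "\<lambda>k. 0 < k \<and> y [^] k \<in> A"]
  show ?thesis using that by blast
qed

text \<open>The trivial character of \<open>N\<close> is first extended to \<open>x\<close> with a
  value other than 1. A maximal further extension is total, because at any missing element a root of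
  the required value exists.\<close>

lemma exists_character_separating:
  assumes fin: "finite (carrier G)" and N: "subgroup N G" and x: "x \<in> carrier G" "x \<notin> N"
  shows "\<exists>\<chi>\<in>hom G circle_group. (\<forall>g\<in>N. \<chi> g = 1) \<and> \<chi> x \<noteq> 1"
proof -
  let ?C = "G \<times>\<times> circle_group"
  interpret C: comm_group ?C by (rule comm_group_DirProd_circle)
  interpret T: comm_group circle_group by (rule comm_group_circle_group)
  have \<Gamma>0: "partial_character G (N \<times> {1})"
    using DirProd_subgroups[OF is_group N T.is_group T.triv_subgroup]
    by (simp add: partial_character_def circle_group_def)
  have oneN: "\<one> \<in> N" using N by (rule subgroup.one_closed)
  obtain r :: nat where r: "0 < r" "x [^] r \<in> N" "\<And>k. 0 < k \<Longrightarrow> k < r \<Longrightarrow> x [^] k \<notin> N"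
    using finite_exists_least_power[OF fin x(1) oneN] by metis
  have "r \<noteq> 1" using r(2) x by auto
  \<comment> \<open>Any r-th root of 1 is an admissible value at \<open>x\<close>, since the trivial
    character takes the value 1 at the r-th power of \<open>x\<close>. As \<open>x\<close> is not in
    \<open>N\<close>, \<open>r\<close> is at least 2 and a primitive root differs from 1.\<close>
  define w where "w = cis (2 * pi / real r)"
  have w: "cmod w = 1" "w ^ r = 1"
    using r(1) by (auto simp: w_def DeMoivre)
  have "w \<noteq> 1"
  proof
    assume "w = 1"
    then have "cos (2 * pi / real r) = 1" by (simp add: w_def complex_eq_iff)
    then obtain k :: int where "2 * pi / real r = of_int k * 2 * pi"
      using cos_one_2pi_int by auto
    then have "1 = real_of_int k * real r" using r(1) by (simp add: field_simps)
    then have "1 = k * int r" by (metis of_int_eq_1_iff of_int_mult of_int_of_nat_eq)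
    then have "int r dvd 1" by (metis dvd_triv_right)
    then show False using \<open>r \<noteq> 1\<close> by simp
  qed
  obtain \<Gamma>1 where \<Gamma>1: "partial_character G \<Gamma>1" "N \<times> {1} \<subseteq> \<Gamma>1" "(x, w) \<in> \<Gamma>1"
    using partial_character_extend[OF \<Gamma>0 x(1) w(1) r(1)] r w by auto
  \<comment> \<open>Such graphs project injectively into the finite carrier, so their cardinality is
    bounded and a largest one exists.\<close>
  let ?Q = "\<lambda>\<Gamma>. partial_character G \<Gamma> \<and> \<Gamma>1 \<subseteq> \<Gamma>"
  have inj: "inj_on fst \<Gamma>" and fstc: "fst ` \<Gamma> \<subseteq> carrier G" if "?Q \<Gamma>" for \<Gamma>
  proof -
    show "inj_on fst \<Gamma>"
      using partial_character_functional that by (auto simp: inj_on_def)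
    show "fst ` \<Gamma> \<subseteq> carrier G"
      using that subgroup.mem_carrier unfolding partial_character_def by fastforce
  qed
  have finG: "finite \<Gamma>" if "?Q \<Gamma>" for \<Gamma>
    using finite_imageD[OF finite_subset[OF fstc[OF that] fin] inj[OF that]] .
  have "\<forall>\<Gamma>. ?Q \<Gamma> \<longrightarrow> card \<Gamma> < Suc (card (carrier G))"
    using card_mono[OF fin fstc] card_image[OF inj] by (metis le_imp_less_Suc)
  then obtain \<Gamma> where \<Gamma>: "?Q \<Gamma>" and max: "\<And>\<Gamma>'. ?Q \<Gamma>' \<Longrightarrow> card \<Gamma>' \<le> card \<Gamma>"
    using ex_has_greatest_nat[of ?Q \<Gamma>1 card] \<Gamma>1(1) by blast
  have sub: "subgroup \<Gamma> ?C" using \<Gamma> by (simp add: partial_character_def)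
  have total: "y \<in> fst ` \<Gamma>" if y: "y \<in> carrier G" for y
  proof (rule ccontr)
    assume ny: "y \<notin> fst ` \<Gamma>"
    have "\<one> \<in> fst ` \<Gamma>" using subgroup.one_closed[OF sub] by force
    then obtain r :: nat where r: "0 < r" "y [^] r \<in> fst ` \<Gamma>"
      "\<And>k. 0 < k \<Longrightarrow> k < r \<Longrightarrow> y [^] k \<notin> fst ` \<Gamma>"
      using finite_exists_least_power[OF fin y] by metis
    then obtain u where u: "(y [^] r, u) \<in> \<Gamma>" by auto
    then have cu: "cmod u = 1" using subgroup.mem_carrier[OF sub] by (force simp: circle_group_def)
    \<comment> \<open>Dividing the argument of \<open>u\<close> by \<open>r\<close> gives an r-th
      root on the unit circle.\<close>
    define v where "v = cis (Arg u / real r)"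
    have "v ^ r = u"
      using r(1) cu by (simp add: v_def DeMoivre cis_Arg_unique) (metis cis_Arg cu norm_zero sgn_eq zero_neq_one div_by_1 of_real_1)
    moreover have "cmod v = 1" by (simp add: v_def)
    ultimately obtain \<Gamma>' where \<Gamma>': "partial_character G \<Gamma>'" "\<Gamma> \<subseteq> \<Gamma>'" "(y, v) \<in> \<Gamma>'"
      using partial_character_extend[of \<Gamma> y v r] \<Gamma> y r u by metis
    then have "?Q \<Gamma>'" using \<Gamma> by blast
    moreover have "\<Gamma> \<subset> \<Gamma>'" using \<Gamma>' ny by force
    ultimately show False using max psubset_card_mono[OF finG] by (metis leD)
  qed
  define \<chi> where "\<chi> = (\<lambda>y. THE z. (y, z) \<in> \<Gamma>)"
  have \<chi>I: "\<chi> y = z" if "(y, z) \<in> \<Gamma>" for y z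
    unfolding \<chi>_def using that partial_character_functional \<Gamma> by blast
  have \<chi>: "(y, \<chi> y) \<in> \<Gamma>" if "y \<in> carrier G" for y
    using total[OF that] \<chi>I by auto
  have "\<chi> \<in> hom G circle_group"
  proof (rule homI)
    show "\<chi> y \<in> carrier circle_group" if "y \<in> carrier G" for y
      using subgroup.mem_carrier[OF sub \<chi>[OF that]] by simp
    show "\<chi> (y \<otimes> z) = \<chi> y \<otimes>\<^bsub>circle_group\<^esub> \<chi> z" if "y \<in> carrier G" "z \<in> carrier G" for y z
      using subgroup.m_closed[OF sub \<chi>[OF that(1)] \<chi>[OF that(2)]] \<chi>I by simp
  qed
  moreover have "\<forall>g\<in>N. \<chi> g = 1" "\<chi> x = w"
    using \<chi>I \<Gamma> \<Gamma>1 by blast+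
  ultimately show ?thesis using \<open>w \<noteq> 1\<close> by blast
qed

end

section \<open>Digit expansions\<close>

text \<open>Digit 1 is the most significant, as in the expansion of a point. Hence forgetting
  trailing columns is integer division by a power of \<open>b\<close>.\<close>

primrec radix :: "nat \<Rightarrow> (nat \<Rightarrow> nat) \<Rightarrow> nat \<Rightarrow> nat" where
  "radix b f 0 = 0"
| "radix b f (Suc d) = b * radix b f d + f (Suc d)"

lemma radix_less: "(\<And>j. j \<in> {1..d} \<Longrightarrow> f j < b) \<Longrightarrow> radix b f d < b ^ d"
proof (induction d)
  case (Suc d)
  have "Suc (radix b f d) \<le> b ^ d" "f (Suc d) < b"
    using Suc by (auto simp: Suc_le_eq)
  then have "b * Suc (radix b f d) \<le> b * b ^ d" using mult_le_mono2 by blast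
  then show ?case using \<open>f (Suc d) < b\<close> by simp
qed simp

lemma radix_eq_iff:
  assumes "\<And>j. j \<in> {1..d} \<Longrightarrow> f j < b" "\<And>j. j \<in> {1..d} \<Longrightarrow> g j < b"
  shows "radix b f d = radix b g d \<longleftrightarrow> (\<forall>j\<in>{1..d}. f j = g j)"
  using assms
proof (induction d)
  case (Suc d)
  have lt: "f (Suc d) < b" "g (Suc d) < b" using Suc.prems by auto
  have "radix b f (Suc d) = radix b g (Suc d) \<longleftrightarrow>
        radix b f d = radix b g d \<and> f (Suc d) = g (Suc d)"
    using lt by (auto dest: arg_cong[of _ _ "\<lambda>x. x div b"] arg_cong[of _ _ "\<lambda>x. x mod b"])
  also have "radix b f d = radix b g d \<longleftrightarrow> (\<forall>j\<in>{1..d}. f j = g j)"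
    using Suc by simp
  finally show ?case by (simp add: atLeastAtMostSuc_conv) blast
qed simp

lemma radix_cong: "(\<And>j. j \<in> {1..d} \<Longrightarrow> f j = g j) \<Longrightarrow> radix b f d = radix b g d"
  by (induction d) auto

lemma radix_surj: "0 < b \<Longrightarrow> a < b ^ d \<Longrightarrow> \<exists>f. (\<forall>j. f j < b) \<and> radix b f d = a"
proof (induction d arbitrary: a)
  case (Suc d)
  have "a div b < b ^ d" using Suc.prems by (simp add: less_mult_imp_div_less mult.commute)
  then obtain f where f: "\<And>j. f j < b" "radix b f d = a div b"
    using Suc by blast
  let ?f = "f(Suc d := a mod b)"
  have "radix b ?f d = radix b f d" by (rule radix_cong) auto
  then have "(\<forall>j. ?f j < b) \<and> radix b ?f (Suc d) = a"
    using f Suc.prems by auto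
  then show ?case by blast
qed auto

lemma radix_div:
  assumes "d \<le> n" "\<And>j. j \<in> {1..n} \<Longrightarrow> f j < b"
  shows "radix b f n div b ^ (n - d) = radix b f d"
  using assms
proof (induction rule: dec_induct)
  case (step n)
  have lt: "f (Suc n) < b" using step.prems by auto
  have "radix b f (Suc n) div b ^ (Suc n - d) = radix b f (Suc n) div b div b ^ (n - d)"
    using step.hyps by (simp add: Suc_diff_le div_mult2_eq)
  also have "radix b f (Suc n) div b = radix b f n" using lt by simp
  finally show ?case using step by simp
qed simp

lemma sum_digits_eq_radix:
  assumes "0 < b"
  shows "(\<Sum>j\<in>{1..n}. real (f j) / real b ^ j) = real (radix b f n) / real b ^ n"
  using assms by (induction n) (simp_all add: field_simps)

text \<open>After scaling by \<open>b ^ n\<close> the half-open interval becomes the integer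
  condition a*q \<le> v < (a+1)*q with \<open>q = b ^ (n - d)\<close>; integrality of q is where
  \<open>d \<le> n\<close> enters.\<close>

lemma mem_elementary_interval_iff:
  assumes "0 < b" "d \<le> n"
  shows "real v / real b ^ n \<in> {real a / real b ^ d ..< (real a + 1) / real b ^ d}
     \<longleftrightarrow> v div b ^ (n - d) = a"
proof -
  define q where "q = b ^ (n - d)"
  have q: "0 < q" and bn: "real b ^ n = real b ^ d * real q"
    using assms by (auto simp: q_def simp flip: power_add)
  have bd: "0 < real b ^ d" "b \<noteq> 0" using assms by simp_all
  have "real a / real b ^ d \<le> real v / real b ^ n \<longleftrightarrow> real (a * q) \<le> real v"
    using q bd by (simp add: bn divide_simps algebra_simps)
  moreover have "real v / real b ^ n < (real a + 1) / real b ^ d \<longleftrightarrow> real v < real ((a + 1) * q)"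
    using q bd by (simp add: bn divide_simps algebra_simps)
  ultimately have "real v / real b ^ n \<in> {real a / real b ^ d ..< (real a + 1) / real b ^ d}
     \<longleftrightarrow> a * q \<le> v \<and> v < (a + 1) * q"
    by (simp only: atLeastLessThan_iff of_nat_le_iff of_nat_less_iff)
  also have "\<dots> \<longleftrightarrow> v div q = a"
  proof
    show "v div q = a" if "a * q \<le> v \<and> v < (a + 1) * q"
      using that by (intro div_nat_eqI) (simp_all add: mult.commute)
    show "a * q \<le> v \<and> v < (a + 1) * q" if "v div q = a"
      using dividend_less_div_times[OF q, of v] unfolding that[symmetric] by simp
  qed
  finally show ?thesis by (simp add: q_def)
qed

section \<open>Matrices, cells and agreement on leading digits\<close>

locale matrix_code = comm_group G for G :: "('a, 'c) monoid_scheme" (structure) +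
  fixes \<phi> :: "nat \<Rightarrow> 'a" and b s n :: nat
  assumes fin: "finite (carrier G)"
    and b: "b \<ge> 2"
    and \<phi>: "bij_betw \<phi> {0..<b} (carrier G)"
begin

abbreviation M :: "(nat \<Rightarrow> nat \<Rightarrow> 'a) monoid" where
  "M \<equiv> matrix_group G s n"

abbreviation digit :: "'a \<Rightarrow> nat" where
  "digit \<equiv> inv_into {0..<b} \<phi>"

abbreviation point :: "(nat \<Rightarrow> nat \<Rightarrow> 'a) \<Rightarrow> nat \<Rightarrow> real" where
  "point \<equiv> point_of_matrix \<phi> b s n"

lemma carrier_M: "carrier M = {1..s} \<rightarrow>\<^sub>E ({1..n} \<rightarrow>\<^sub>E carrier G)"
  by (simp add: matrix_group_def row_group_def)

lemma entry_closed [simp]: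
  "X \<in> carrier M \<Longrightarrow> i \<in> {1..s} \<Longrightarrow> j \<in> {1..n} \<Longrightarrow> X i j \<in> carrier G"
  by (auto simp: carrier_M PiE_iff)

lemma matrix_eqI:
  assumes "X \<in> carrier M" "Y \<in> carrier M"
    and "\<And>i j. i \<in> {1..s} \<Longrightarrow> j \<in> {1..n} \<Longrightarrow> X i j = Y i j"
  shows "X = Y"
proof (rule PiE_ext)
  show "X \<in> {1..s} \<rightarrow>\<^sub>E ({1..n} \<rightarrow>\<^sub>E carrier G)" "Y \<in> {1..s} \<rightarrow>\<^sub>E ({1..n} \<rightarrow>\<^sub>E carrier G)"
    using assms by (simp_all add: carrier_M)
  then show "X i = Y i" if "i \<in> {1..s}" for i
    using that assms(3) by (intro PiE_ext[of "X i" "{1..n}" "\<lambda>_. carrier G" "Y i"]) (auto simp: PiE_iff)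
qed

lemma mult_M_entry [simp]:
  "i \<in> {1..s} \<Longrightarrow> j \<in> {1..n} \<Longrightarrow> (X \<otimes>\<^bsub>M\<^esub> Y) i j = X i j \<otimes> Y i j"
  by (simp add: matrix_group_def row_group_def)

lemma one_M_entry [simp]:
  "i \<in> {1..s} \<Longrightarrow> j \<in> {1..n} \<Longrightarrow> \<one>\<^bsub>M\<^esub> i j = \<one>"
  by (simp add: matrix_group_def row_group_def)

lemma group_M: "group M"
  by (simp add: matrix_group_def row_group_def)

lemma comm_group_M: "comm_group M"
proof (rule group.group_comm_groupI[OF group_M])
  fix X Y assume XY: "X \<in> carrier M" "Y \<in> carrier M"
  interpret M: group M by (rule group_M)
  show "X \<otimes>\<^bsub>M\<^esub> Y = Y \<otimes>\<^bsub>M\<^esub> X"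
    using XY by (intro matrix_eqI) (simp_all add: m_comm)
qed

sublocale M: comm_group M by (rule comm_group_M)

lemma inv_M_entry [simp]:
  assumes "X \<in> carrier M" "i \<in> {1..s}" "j \<in> {1..n}"
  shows "(inv\<^bsub>M\<^esub> X) i j = inv (X i j)"
proof -
  have "(inv\<^bsub>M\<^esub> X \<otimes>\<^bsub>M\<^esub> X) i j = \<one>"
    using assms by (simp del: mult_M_entry)
  then have "(inv\<^bsub>M\<^esub> X) i j \<otimes> X i j = \<one>"
    unfolding mult_M_entry[OF assms(2,3)] .
  then show ?thesis
    using assms by (intro inv_equality[symmetric]) simp_all
qed

lemma finite_carrier_M: "finite (carrier M)"
  unfolding carrier_M by (intro finite_PiE finite_atLeastAtMost fin)

lemma digit_less: "x \<in> carrier G \<Longrightarrow> digit x < b"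
  using inv_into_into[of x \<phi> "{0..<b}"] \<phi> by (auto simp: bij_betw_def)

lemma digit_eq_iff: "x \<in> carrier G \<Longrightarrow> y \<in> carrier G \<Longrightarrow> digit x = digit y \<longleftrightarrow> x = y"
  using bij_betw_inv_into[OF \<phi>] by (auto simp: bij_betw_def inj_on_def)

lemma digit_\<phi>: "k < b \<Longrightarrow> digit (\<phi> k) = k"
  using \<phi> by (simp add: bij_betw_def inv_into_f_f)

lemma \<phi>_closed: "k < b \<Longrightarrow> \<phi> k \<in> carrier G"
  using \<phi> by (auto simp: bij_betw_def)

text \<open>Equality after restriction to the leading positions, kept as a relation on full matrices
  so that no group of truncated matrices is needed. The matrices agreeing with the unit form the
  kernel of the restriction.\<close>

definition agree :: "(nat \<Rightarrow> nat) \<Rightarrow> (nat \<Rightarrow> nat \<Rightarrow> 'a) \<Rightarrow> (nat \<Rightarrow> nat \<Rightarrow> 'a) \<Rightarrow> bool" where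
  "agree d X Y \<longleftrightarrow> (\<forall>i\<in>{1..s}. \<forall>j\<in>{1..d i}. X i j = Y i j)"

text \<open>
  \<open>cell d X i\<close> is the integer \<open>a\<^sub>i\<close> with \<open>a\<^sub>i / b ^ d i \<le> point X i < (a\<^sub>i + 1) / b ^ d i\<close>.
\<close>

definition cell :: "(nat \<Rightarrow> nat) \<Rightarrow> (nat \<Rightarrow> nat \<Rightarrow> 'a) \<Rightarrow> nat \<Rightarrow> nat" where
  "cell d X = (\<lambda>i\<in>{1..s}. radix b (\<lambda>j. digit (X i j)) (d i))"

lemma cell_eq_iff:
  assumes d: "\<And>i. i \<in> {1..s} \<Longrightarrow> d i \<le> n" and XY: "X \<in> carrier M" "Y \<in> carrier M"
  shows "cell d X = cell d Y \<longleftrightarrow> agree d X Y"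
proof -
  have "cell d X = cell d Y \<longleftrightarrow> (\<forall>i\<in>{1..s}. cell d X i = cell d Y i)"
    by (auto simp: cell_def restrict_def fun_eq_iff)
  also have "\<dots> \<longleftrightarrow> agree d X Y"
    unfolding agree_def
  proof (rule ball_cong[OF refl])
    fix i assume i: "i \<in> {1..s}"
    have c: "X i j \<in> carrier G" "Y i j \<in> carrier G" if "j \<in> {1..d i}" for j
      using that d[OF i] XY i by simp_all
    have "cell d X i = cell d Y i \<longleftrightarrow>
        radix b (\<lambda>j. digit (X i j)) (d i) = radix b (\<lambda>j. digit (Y i j)) (d i)"
      using i by (simp add: cell_def)
    also have "\<dots> \<longleftrightarrow> (\<forall>j\<in>{1..d i}. digit (X i j) = digit (Y i j))"
      by (rule radix_eq_iff) (use c digit_less in blast)+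
    also have "\<dots> \<longleftrightarrow> (\<forall>j\<in>{1..d i}. X i j = Y i j)"
      by (rule ball_cong[OF refl]) (use c digit_eq_iff in blast)
    finally show "cell d X i = cell d Y i \<longleftrightarrow> (\<forall>j\<in>{1..d i}. X i j = Y i j)" .
  qed
  finally show ?thesis .
qed

lemma cell_mem:
  assumes d: "\<And>i. i \<in> {1..s} \<Longrightarrow> d i \<le> n" and X: "X \<in> carrier M"
  shows "cell d X \<in> (\<Pi>\<^sub>E i\<in>{1..s}. {..<b ^ d i})"
proof (rule PiE_I)
  fix i assume i: "i \<in> {1..s}"
  have "digit (X i j) < b" if "j \<in> {1..d i}" for j
    using that d[OF i] X i by (simp add: digit_less)
  then show "cell d X i \<in> {..<b ^ d i}" using i radix_less by (simp add: cell_def)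
qed (auto simp: cell_def)

lemma cell_surj:
  assumes d: "\<And>i. i \<in> {1..s} \<Longrightarrow> d i \<le> n" and a: "a \<in> (\<Pi>\<^sub>E i\<in>{1..s}. {..<b ^ d i})"
  shows "\<exists>Y\<in>carrier M. cell d Y = a"
proof -
  have "\<forall>i\<in>{1..s}. \<exists>f. (\<forall>j. f j < b) \<and> radix b f (d i) = a i"
    using a b by (intro ballI radix_surj) auto
  then obtain f where f: "\<And>i j. i \<in> {1..s} \<Longrightarrow> f i j < b"
      "\<And>i. i \<in> {1..s} \<Longrightarrow> radix b (f i) (d i) = a i"
    by metis
  \<comment> \<open>Columns beyond \<open>d i\<close> are filled with whatever \<open>f i\<close>
    supplies there; it only has to be a digit.\<close>
  define Y where "Y = (\<lambda>i\<in>{1..s}. \<lambda>j\<in>{1..n}. \<phi> (f i j))"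
  have "Y \<in> carrier M" using f by (auto simp: Y_def carrier_M \<phi>_closed)
  moreover have "cell d Y = a"
  proof
    fix i show "cell d Y i = a i"
    proof (cases "i \<in> {1..s}")
      case True
      have "radix b (\<lambda>j. digit (Y i j)) (d i) = radix b (f i) (d i)"
        using True d[OF True] f by (intro radix_cong) (auto simp: Y_def digit_\<phi>)
      then show ?thesis using True f by (simp add: cell_def)
    next
      case False
      then show ?thesis using PiE_arb[OF a False] by (auto simp: cell_def)
    qed
  qed
  ultimately show ?thesis by blast
qed

lemma point_eq_radix:
  "i \<in> {1..s} \<Longrightarrow> point X i = real (radix b (\<lambda>j. digit (X i j)) n) / real b ^ n"
  using b by (simp add: point_of_matrix_def sum_digits_eq_radix del: One_nat_def)

lemma point_mem_box_iff:
  assumes d: "\<And>i. i \<in> {1..s} \<Longrightarrow> d i \<le> n" and X: "X \<in> carrier M"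
  shows "point X \<in> (\<Pi>\<^sub>E i\<in>{1..s}. {real (a i) / real b ^ d i ..< (real (a i) + 1) / real b ^ d i})
     \<longleftrightarrow> (\<forall>i\<in>{1..s}. cell d X i = a i)"
proof -
  have "point X i \<in> {real (a i) / real b ^ d i ..< (real (a i) + 1) / real b ^ d i}
      \<longleftrightarrow> cell d X i = a i" if i: "i \<in> {1..s}" for i
  proof -
    have "radix b (\<lambda>j. digit (X i j)) n div b ^ (n - d i) = cell d X i"
      using i d[OF i] X radix_div[of "d i" n "\<lambda>j. digit (X i j)" b] by (simp add: cell_def digit_less del: One_nat_def)
    then show ?thesis
      using mem_elementary_interval_iff[of b "d i" n] d[OF i] b by (simp add: point_eq_radix[OF i])
  qed
  moreover have "point X \<in> extensional {1..s}" by (simp add: point_of_matrix_def)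
  ultimately show ?thesis by (simp add: PiE_iff del: One_nat_def atLeastAtMost_iff atLeastLessThan_iff)
qed

text \<open>Expansions of fixed length \<open>n\<close> are unique: with \<open>d\<close> constantly
  \<open>n\<close>, the cell records all digits.\<close>

lemma inj_on_point: "inj_on point (carrier M)"
proof (rule inj_onI)
  fix X Y assume XY: "X \<in> carrier M" "Y \<in> carrier M" and eq: "point X = point Y"
  have "cell (\<lambda>_. n) X = cell (\<lambda>_. n) Y"
    unfolding cell_def
  proof (rule restrict_ext)
    fix i assume i: "i \<in> {1..s}"
    show "radix b (\<lambda>j. digit (X i j)) n = radix b (\<lambda>j. digit (Y i j)) n"
      using fun_cong[OF eq, of i] b by (simp add: point_eq_radix[OF i])
  qed
  then have "agree (\<lambda>_. n) X Y" using XY by (simp add: cell_eq_iff)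
  then show "X = Y" using XY by (intro matrix_eqI) (auto simp: agree_def)
qed

lemma point_mem_unit_cube:
  assumes X: "X \<in> carrier M"
  shows "point X \<in> (\<Pi>\<^sub>E i\<in>{1..s}. {0..<1})"
proof -
  \<comment> \<open>The unit cube is the only elementary box of shape 0.\<close>
  have "cell (\<lambda>_. 0) X \<in> (\<Pi>\<^sub>E i\<in>{1..s}. {..<b ^ 0})"
    by (rule cell_mem[OF _ X]) simp
  then have "\<forall>i\<in>{1..s}. cell (\<lambda>_. 0) X i = 0" by (auto simp: PiE_iff)
  then show ?thesis
    using point_mem_box_iff[of "\<lambda>_. 0" X "\<lambda>_. 0"] X by simp
qed

text \<open>Injectivity moves the count from points to matrices. Replacing arbitrary
  \<open>a\<close> by extensional ones makes the cells of a given shape a finite set that can be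
  summed over.\<close>

lemma is_comb_net_iff:
  assumes P: "P \<subseteq> carrier M" "card P = b ^ m" and t: "t \<le> m" and mn: "m \<le> n"
  shows "is_comb_net \<phi> n t m s b P \<longleftrightarrow>
     (\<forall>d. (\<Sum>i\<in>{1..s}. d i) = m - t \<longrightarrow>
        (\<forall>a\<in>(\<Pi>\<^sub>E i\<in>{1..s}. {..<b ^ d i}). card {X\<in>P. cell d X = a} = b ^ t))"
proof -
  have inj: "inj_on point P" using inj_on_point P(1) by (rule inj_on_subset)
  have count: "card (point ` P \<inter> (\<Pi>\<^sub>E i\<in>{1..s}. {real (a i) / real b ^ d i ..< (real (a i) + 1) / real b ^ d i}))
      = card {X\<in>P. cell d X = (\<lambda>i\<in>{1..s}. a i)}"
    if d: "(\<Sum>i\<in>{1..s}. d i) = m - t" for a d :: "nat \<Rightarrow> nat"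
  proof -
    \<comment> \<open>No entry exceeds the total m - t, and \<open>m \<le> n\<close> then keeps
      every cell within the available columns.\<close>
    have dn: "d i \<le> n" if "i \<in> {1..s}" for i
      using member_le_sum[OF that, of d] d mn by simp
    let ?B = "\<Pi>\<^sub>E i\<in>{1..s}. {real (a i) / real b ^ d i ..< (real (a i) + 1) / real b ^ d i}"
    have "point X \<in> ?B \<longleftrightarrow> cell d X = (\<lambda>i\<in>{1..s}. a i)" if "X \<in> P" for X
    proof -
      have "point X \<in> ?B \<longleftrightarrow> (\<forall>i\<in>{1..s}. cell d X i = a i)"
        using that P(1) by (intro point_mem_box_iff dn) auto
      also have "\<dots> \<longleftrightarrow> cell d X = (\<lambda>i\<in>{1..s}. a i)"
        by (auto simp: cell_def restrict_def fun_eq_iff)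
      finally show ?thesis .
    qed
    then have "point ` P \<inter> ?B = point ` {X\<in>P. cell d X = (\<lambda>i\<in>{1..s}. a i)}" by blast
    moreover have "inj_on point {X\<in>P. cell d X = (\<lambda>i\<in>{1..s}. a i)}"
      using inj by (rule inj_on_subset) blast
    ultimately show ?thesis by (simp add: card_image)
  qed
  have "is_comb_net \<phi> n t m s b P \<longleftrightarrow>
     (\<forall>d a :: nat \<Rightarrow> nat. (\<Sum>i\<in>{1..s}. d i) = m - t \<and> (\<forall>i\<in>{1..s}. a i < b ^ d i) \<longrightarrow>
        card {X\<in>P. cell d X = (\<lambda>i\<in>{1..s}. a i)} = b ^ t)"
    unfolding is_comb_net_def is_net_def
    using P t card_image[OF inj] point_mem_unit_cube count by (auto simp del: One_nat_def atLeastAtMost_iff)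
  also have "\<dots> \<longleftrightarrow> (\<forall>d. (\<Sum>i\<in>{1..s}. d i) = m - t \<longrightarrow>
        (\<forall>a\<in>(\<Pi>\<^sub>E i\<in>{1..s}. {..<b ^ d i}). card {X\<in>P. cell d X = a} = b ^ t))"
    (is "?L \<longleftrightarrow> ?R")
  proof
    assume L: ?L
    show ?R
    proof (intro allI impI ballI)
      fix d a assume "(\<Sum>i\<in>{1..s}. d i) = m - t" and a: "a \<in> (\<Pi>\<^sub>E i\<in>{1..s}. {..<b ^ d i})"
      moreover from a have "\<forall>i\<in>{1..s}. a i < b ^ d i" by auto
      ultimately have "card {X\<in>P. cell d X = (\<lambda>i\<in>{1..s}. a i)} = b ^ t"
        using L by blast
      then show "card {X\<in>P. cell d X = a} = b ^ t"
        unfolding PiE_restrict[OF a] .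
    qed
  next
    assume R: ?R
    show ?L
    proof (intro allI impI, elim conjE)
      fix d a :: "nat \<Rightarrow> nat"
      assume "(\<Sum>i\<in>{1..s}. d i) = m - t" "\<forall>i\<in>{1..s}. a i < b ^ d i"
      moreover from this have "(\<lambda>i\<in>{1..s}. a i) \<in> (\<Pi>\<^sub>E i\<in>{1..s}. {..<b ^ d i})" by auto
      ultimately show "card {X\<in>P. cell d X = (\<lambda>i\<in>{1..s}. a i)} = b ^ t" using R by blast
    qed
  qed
  finally show ?thesis .
qed

section \<open>Fibres of a subgroup over the cells\<close>

lemma agree_refl [simp]: "agree d X X"
  by (simp add: agree_def)

lemma agree_mult:
  assumes "\<And>i. i \<in> {1..s} \<Longrightarrow> d i \<le> n" "agree d X Y" "agree d X' Y'"
  shows "agree d (X \<otimes>\<^bsub>M\<^esub> X') (Y \<otimes>\<^bsub>M\<^esub> Y')"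
  using assms by (fastforce simp: agree_def)

lemma agree_inv:
  assumes "\<And>i. i \<in> {1..s} \<Longrightarrow> d i \<le> n" "agree d X Y" "X \<in> carrier M" "Y \<in> carrier M"
  shows "agree d (inv\<^bsub>M\<^esub> X) (inv\<^bsub>M\<^esub> Y)"
  using assms by (fastforce simp: agree_def)

text \<open>Translation by \<open>Y\<close> carries the kernel part of \<open>P\<close> onto the
  fibre through \<open>Y\<close>.\<close>

lemma card_agree_subgroup:
  assumes d: "\<And>i. i \<in> {1..s} \<Longrightarrow> d i \<le> n" and P: "subgroup P M" and Y: "Y \<in> P"
  shows "card {X\<in>P. agree d X Y} = card {X\<in>P. agree d X \<one>\<^bsub>M\<^esub>}"
proof -
  have Pc: "X \<in> carrier M" if "X \<in> P" for X using subgroup.mem_carrier[OF P that] .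
  have "bij_betw (\<lambda>X. Y \<otimes>\<^bsub>M\<^esub> X) {X\<in>P. agree d X \<one>\<^bsub>M\<^esub>} {X\<in>P. agree d X Y}"
  proof (rule bij_betw_byWitness[where f' = "\<lambda>X. inv\<^bsub>M\<^esub> Y \<otimes>\<^bsub>M\<^esub> X"])
    show "\<forall>X\<in>{X\<in>P. agree d X \<one>\<^bsub>M\<^esub>}. inv\<^bsub>M\<^esub> Y \<otimes>\<^bsub>M\<^esub> (Y \<otimes>\<^bsub>M\<^esub> X) = X"
      using Pc Y by (simp flip: M.m_assoc)
    show "\<forall>X\<in>{X\<in>P. agree d X Y}. Y \<otimes>\<^bsub>M\<^esub> (inv\<^bsub>M\<^esub> Y \<otimes>\<^bsub>M\<^esub> X) = X"
      using Pc Y by (simp flip: M.m_assoc)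
    show "(\<lambda>X. Y \<otimes>\<^bsub>M\<^esub> X) ` {X\<in>P. agree d X \<one>\<^bsub>M\<^esub>} \<subseteq> {X\<in>P. agree d X Y}"
    proof (intro image_subsetI CollectI conjI; elim CollectE conjE)
      fix X assume X: "X \<in> P" "agree d X \<one>\<^bsub>M\<^esub>"
      show "Y \<otimes>\<^bsub>M\<^esub> X \<in> P" using X Y by (simp add: subgroup.m_closed[OF P])
      have "agree d (Y \<otimes>\<^bsub>M\<^esub> X) (Y \<otimes>\<^bsub>M\<^esub> \<one>\<^bsub>M\<^esub>)"
        using d agree_refl X(2) by (rule agree_mult)
      then show "agree d (Y \<otimes>\<^bsub>M\<^esub> X) Y" using Pc Y by simp
    qed
    show "(\<lambda>X. inv\<^bsub>M\<^esub> Y \<otimes>\<^bsub>M\<^esub> X) ` {X\<in>P. agree d X Y} \<subseteq> {X\<in>P. agree d X \<one>\<^bsub>M\<^esub>}"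
    proof (intro image_subsetI CollectI conjI; elim CollectE conjE)
      fix X assume X: "X \<in> P" "agree d X Y"
      show "inv\<^bsub>M\<^esub> Y \<otimes>\<^bsub>M\<^esub> X \<in> P"
        using X Y by (simp add: subgroup.m_closed[OF P] subgroup.m_inv_closed[OF P])
      have "agree d (inv\<^bsub>M\<^esub> Y \<otimes>\<^bsub>M\<^esub> X) (inv\<^bsub>M\<^esub> Y \<otimes>\<^bsub>M\<^esub> Y)"
        using d agree_refl X(2) by (rule agree_mult)
      then show "agree d (inv\<^bsub>M\<^esub> Y \<otimes>\<^bsub>M\<^esub> X) \<one>\<^bsub>M\<^esub>" using Pc Y by simp
    qed
  qed
  then show ?thesis by (rule bij_betw_same_card[symmetric])
qed

lemma card_eq_sum_cells:
  assumes d: "\<And>i. i \<in> {1..s} \<Longrightarrow> d i \<le> n" and P: "P \<subseteq> carrier M"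
  shows "card P = (\<Sum>a\<in>(\<Pi>\<^sub>E i\<in>{1..s}. {..<b ^ d i}). card {X\<in>P. cell d X = a})"
proof -
  have finP: "finite P" using finite_subset[OF P finite_carrier_M] .
  have "cell d X \<in> (\<Pi>\<^sub>E i\<in>{1..s}. {..<b ^ d i})" if "X \<in> P" for X
    using d subsetD[OF P that] by (rule cell_mem)
  then have "P = (\<Union>a\<in>(\<Pi>\<^sub>E i\<in>{1..s}. {..<b ^ d i}). {X\<in>P. cell d X = a})"
    by auto
  then have "card P = card (\<Union>a\<in>(\<Pi>\<^sub>E i\<in>{1..s}. {..<b ^ d i}). {X\<in>P. cell d X = a})" by simp
  also have "\<dots> = (\<Sum>a\<in>(\<Pi>\<^sub>E i\<in>{1..s}. {..<b ^ d i}). card {X\<in>P. cell d X = a})"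
    using finP by (intro card_UN_disjoint finite_PiE) auto
  finally show ?thesis .
qed

lemma card_cells: "card (\<Pi>\<^sub>E i\<in>{1..s}. {..<b ^ d i}) = b ^ (\<Sum>i\<in>{1..s}. d i)"
  by (simp add: card_PiE power_sum)

lemma cells_nonempty_iff:
  assumes d: "\<And>i. i \<in> {1..s} \<Longrightarrow> d i \<le> n" and P: "P \<subseteq> carrier M"
  shows "(\<forall>Y\<in>carrier M. \<exists>X\<in>P. agree d X Y) \<longleftrightarrow>
    (\<forall>a\<in>(\<Pi>\<^sub>E i\<in>{1..s}. {..<b ^ d i}). {X\<in>P. cell d X = a} \<noteq> {})" (is "?L \<longleftrightarrow> ?R")
proof
  assume L: ?L
  show ?R
  proof
    fix a assume "a \<in> (\<Pi>\<^sub>E i\<in>{1..s}. {..<b ^ d i})"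
    from cell_surj[OF d this] obtain Y where Y: "Y \<in> carrier M" "cell d Y = a" by blast
    then obtain X where X: "X \<in> P" "agree d X Y" using L by blast
    have "cell d X = cell d Y"
      using cell_eq_iff[OF d subsetD[OF P X(1)] Y(1)] X(2) by simp
    then show "{X\<in>P. cell d X = a} \<noteq> {}" using X Y by auto
  qed
next
  assume R: ?R
  show ?L
  proof
    fix Y assume Y: "Y \<in> carrier M"
    have "{X\<in>P. cell d X = cell d Y} \<noteq> {}"
      using R cell_mem[OF d Y] by (rule bspec)
    then obtain X where X: "X \<in> P" "cell d X = cell d Y" by blast
    then have "agree d X Y" using cell_eq_iff[OF d subsetD[OF P X(1)] Y] by simp
    then show "\<exists>X\<in>P. agree d X Y" using X by blast
  qed
qed

lemma comb_net_iff_agree: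
  assumes P: "subgroup P M" "card P = b ^ m" and t: "t \<le> m" and mn: "m \<le> n"
  shows "is_comb_net \<phi> n t m s b P \<longleftrightarrow>
     (\<forall>d. (\<Sum>i\<in>{1..s}. d i) = m - t \<longrightarrow> (\<forall>Y\<in>carrier M. \<exists>X\<in>P. agree d X Y))"
proof -
  have Pc: "P \<subseteq> carrier M" using subgroup.subset[OF P(1)] .
  have "(\<forall>a\<in>(\<Pi>\<^sub>E i\<in>{1..s}. {..<b ^ d i}). card {X\<in>P. cell d X = a} = b ^ t) \<longleftrightarrow>
        (\<forall>Y\<in>carrier M. \<exists>X\<in>P. agree d X Y)" (is "?L \<longleftrightarrow> ?R")
    if sd: "(\<Sum>i\<in>{1..s}. d i) = m - t" for d
  proof -
    have d: "d i \<le> n" if "i \<in> {1..s}" for i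
      using member_le_sum[OF that, of d] sd mn by simp
    let ?c = "card {X\<in>P. agree d X \<one>\<^bsub>M\<^esub>}"
    have fibre: "card {X\<in>P. cell d X = a} = ?c" if ne: "{X\<in>P. cell d X = a} \<noteq> {}" for a
    proof -
      obtain Y where Y: "Y \<in> P" "cell d Y = a" using ne by auto
      have "cell d X = cell d Y \<longleftrightarrow> agree d X Y" if "X \<in> P" for X
        using d subsetD[OF Pc that] subsetD[OF Pc Y(1)] by (rule cell_eq_iff)
      then have "{X\<in>P. cell d X = a} = {X\<in>P. agree d X Y}" using Y by auto
      then show ?thesis using card_agree_subgroup[OF d P(1) Y(1)] by simp
    qed
    have "?L \<longleftrightarrow> (\<forall>a\<in>(\<Pi>\<^sub>E i\<in>{1..s}. {..<b ^ d i}). {X\<in>P. cell d X = a} \<noteq> {})" (is "_ \<longleftrightarrow> ?S")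
    proof
      assume L: ?L
      show ?S
      proof
        fix a assume "a \<in> (\<Pi>\<^sub>E i\<in>{1..s}. {..<b ^ d i})"
        with L have "card {X\<in>P. cell d X = a} = b ^ t" by (rule bspec)
        then have "0 < card {X\<in>P. cell d X = a}" using b by simp
        then show "{X\<in>P. cell d X = a} \<noteq> {}" unfolding card_gt_0_iff by blast
      qed
    next
      assume S: ?S
      \<comment> \<open>All \<open>b ^ (m - t)\<close> cells are met and share the fibre size
        \<open>?c\<close>, so counting \<open>P\<close> leaves only \<open>b ^ t\<close> for
        it.\<close>
      have "b ^ m = (\<Sum>a\<in>(\<Pi>\<^sub>E i\<in>{1..s}. {..<b ^ d i}). card {X\<in>P. cell d X = a})"
        using card_eq_sum_cells[OF d Pc] P(2) by simp
      also have "\<dots> = (\<Sum>a\<in>(\<Pi>\<^sub>E i\<in>{1..s}. {..<b ^ d i}). ?c)"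
        by (intro sum.cong refl fibre bspec[OF S])
      also have "\<dots> = b ^ (m - t) * ?c" using card_cells[of d] sd by simp
      also have "b ^ m = b ^ (m - t) * b ^ t" using t by (simp flip: power_add)
      finally have "?c = b ^ t" using b by simp
      then show ?L using fibre[OF bspec[OF S]] by simp
    qed
    also have "\<dots> \<longleftrightarrow> ?R" by (rule cells_nonempty_iff[OF d Pc, symmetric])
    finally show ?thesis .
  qed
  then show ?thesis using is_comb_net_iff[OF Pc P(2) t mn] by blast
qed

text \<open>Pigeonhole: \<open>P\<close> meets each of the b^(sum of d) cells but has only
  \<open>b ^ m\<close> elements. The total of \<open>d\<close> is not restricted beforehand, so this
  applies to shapes larger than those in the net condition.\<close>

lemma agree_imp_sum_le:
  assumes d: "\<And>i. i \<in> {1..s} \<Longrightarrow> d i \<le> n" and P: "P \<subseteq> carrier M" "card P = b ^ m"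
    and all: "\<forall>Y\<in>carrier M. \<exists>X\<in>P. agree d X Y"
  shows "(\<Sum>i\<in>{1..s}. d i) \<le> m"
proof -
  have finP: "finite P" using finite_subset[OF P(1) finite_carrier_M] .
  have ne: "\<forall>a\<in>(\<Pi>\<^sub>E i\<in>{1..s}. {..<b ^ d i}). {X\<in>P. cell d X = a} \<noteq> {}"
    using all cells_nonempty_iff[OF d P(1)] by simp
  have "(\<Pi>\<^sub>E i\<in>{1..s}. {..<b ^ d i}) \<subseteq> cell d ` P"
  proof
    fix a assume "a \<in> (\<Pi>\<^sub>E i\<in>{1..s}. {..<b ^ d i})"
    from bspec[OF ne this] show "a \<in> cell d ` P" by blast
  qed
  from surj_card_le[OF finP this] have "b ^ (\<Sum>i\<in>{1..s}. d i) \<le> b ^ m"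
    unfolding card_cells P(2) .
  then show ?thesis using b by simp
qed

section \<open>Duality\<close>

abbreviation D :: "(nat \<Rightarrow> nat \<Rightarrow> 'a \<Rightarrow> complex) monoid" where
  "D \<equiv> matrix_group (dual_group G) s n"

text \<open>The embedding of \<open>G\<close> as the factor at position (i, j). Composing a
  character of \<open>M\<close> with it gives the corresponding entry of a dual matrix.\<close>

definition single :: "nat \<Rightarrow> nat \<Rightarrow> 'a \<Rightarrow> nat \<Rightarrow> nat \<Rightarrow> 'a" where
  "single i j g = (\<lambda>i'\<in>{1..s}. \<lambda>j'\<in>{1..n}. if i' = i \<and> j' = j then g else \<one>)"

definition supported :: "(nat \<Rightarrow> nat) \<Rightarrow> (nat \<Rightarrow> nat \<Rightarrow> 'a \<Rightarrow> complex) \<Rightarrow> bool" where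
  "supported d K \<longleftrightarrow> (\<forall>i\<in>{1..s}. \<forall>j\<in>{1..n}. d i < j \<longrightarrow> K i j = \<one>\<^bsub>dual_group G\<^esub>)"

lemma single_entry:
  "i' \<in> {1..s} \<Longrightarrow> j' \<in> {1..n} \<Longrightarrow> single i j g i' j' = (if i' = i \<and> j' = j then g else \<one>)"
  by (simp add: single_def)

lemma single_closed: "g \<in> carrier G \<Longrightarrow> single i j g \<in> carrier M"
  by (auto simp: single_def carrier_M)

lemma single_mult:
  assumes "g \<in> carrier G" "h \<in> carrier G"
  shows "single i j (g \<otimes> h) = single i j g \<otimes>\<^bsub>M\<^esub> single i j h"
  using assms
  by (intro matrix_eqI M.m_closed single_closed m_closed) (simp_all only: mult_M_entry single_entry, simp)

text \<open>A character of a finite product is the product of its restrictions to the factors,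
  because \<open>X\<close> is the product of its \<open>single\<close> matrices.\<close>

lemma hom_matrix_decomposition:
  assumes \<Psi>: "\<Psi> \<in> hom M circle_group" and X: "X \<in> carrier M"
  shows "\<Psi> X = (\<Prod>i\<in>{1..s}. \<Prod>j\<in>{1..n}. \<Psi> (single i j (X i j)))"
proof -
  interpret T: comm_group circle_group by (rule comm_group_circle_group)
  \<comment> \<open>Keeping only the entries in \<open>S\<close> allows induction over sets of
    positions: inserting one position multiplies by one \<open>single\<close> matrix.\<close>
  define trunc where
    "trunc S = (\<lambda>i\<in>{1..s}. \<lambda>j\<in>{1..n}. if (i, j) \<in> S then X i j else \<one>)" for S
  have trunc_entry: "trunc S i j = (if (i, j) \<in> S then X i j else \<one>)"
    if "i \<in> {1..s}" "j \<in> {1..n}" for S i j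
    using that by (simp add: trunc_def)
  have trunc_closed: "trunc S \<in> carrier M" for S
    unfolding carrier_M trunc_def using X by (auto intro: entry_closed)
  have \<Psi>_one: "\<Psi> \<one>\<^bsub>M\<^esub> = 1"
    using hom_one[OF \<Psi> group_M T.is_group] by (simp add: circle_group_def)
  have \<Psi>_mult: "\<Psi> (A \<otimes>\<^bsub>M\<^esub> B) = \<Psi> A * \<Psi> B" if "A \<in> carrier M" "B \<in> carrier M" for A B
    using hom_mult[OF \<Psi> that] by (simp add: circle_group_def)
  have "\<Psi> (trunc S) = (\<Prod>(i, j)\<in>S. \<Psi> (single i j (X i j)))"
    if "finite S" "S \<subseteq> {1..s} \<times> {1..n}" for S
    using that
  proof (induction S)
    case empty
    have "trunc {} = \<one>\<^bsub>M\<^esub>"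
      by (intro matrix_eqI trunc_closed M.one_closed) (simp_all only: trunc_entry one_M_entry, simp)
    then show ?case by (simp add: \<Psi>_one)
  next
    case (insert p S)
    obtain i j where p: "p = (i, j)" by (cases p)
    then have ij: "i \<in> {1..s}" "j \<in> {1..n}" using insert.prems by auto
    have sc: "single i j (X i j) \<in> carrier M"
      using X ij by (intro single_closed entry_closed)
    have "trunc (insert p S) = single i j (X i j) \<otimes>\<^bsub>M\<^esub> trunc S"
    proof (rule matrix_eqI[OF trunc_closed M.m_closed[OF sc trunc_closed]])
      fix i' j' assume i'j': "i' \<in> {1..s}" "j' \<in> {1..n}"
      have "X i' j' \<in> carrier G" using X i'j' by (rule entry_closed)
      then show "trunc (insert p S) i' j' = (single i j (X i j) \<otimes>\<^bsub>M\<^esub> trunc S) i' j'"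
        unfolding mult_M_entry[OF i'j'] trunc_entry[OF i'j'] single_entry[OF i'j']
        using insert.hyps p by auto
    qed
    then have "\<Psi> (trunc (insert p S)) = \<Psi> (single i j (X i j)) * \<Psi> (trunc S)"
      by (simp only: \<Psi>_mult[OF sc trunc_closed])
    then show ?case using insert p by simp
  qed
  from this[of "{1..s} \<times> {1..n}"]
  have "\<Psi> (trunc ({1..s} \<times> {1..n})) = (\<Prod>i\<in>{1..s}. \<Prod>j\<in>{1..n}. \<Psi> (single i j (X i j)))"
    by (simp add: prod.cartesian_product)
  moreover have "trunc ({1..s} \<times> {1..n}) = X"
    by (intro matrix_eqI trunc_closed X) (simp only: trunc_entry, simp)
  ultimately show ?thesis by simp
qed

section \<open>Dual matrices and the annihilator\<close>

lemma carrier_D: "carrier D = {1..s} \<rightarrow>\<^sub>E ({1..n} \<rightarrow>\<^sub>E carrier (dual_group G))"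
  by (simp add: matrix_group_def row_group_def)

lemma one_D_entry:
  "i \<in> {1..s} \<Longrightarrow> j \<in> {1..n} \<Longrightarrow> \<one>\<^bsub>D\<^esub> i j = \<one>\<^bsub>dual_group G\<^esub>"
  by (simp add: matrix_group_def row_group_def)

lemma one_dual_apply: "g \<in> carrier G \<Longrightarrow> \<one>\<^bsub>dual_group G\<^esub> g = 1"
  by (simp add: dual_group_def)

lemma one_dual_closed: "\<one>\<^bsub>dual_group G\<^esub> \<in> carrier (dual_group G)"
  by (auto simp: dual_group_def hom_def circle_group_def)

lemma character_one:
  assumes "\<kappa> \<in> carrier (dual_group G)"
  shows "\<kappa> \<one> = 1"
proof -
  interpret T: comm_group circle_group by (rule comm_group_circle_group)
  have "\<kappa> \<in> hom G circle_group" using assms by (simp add: dual_group_def)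
  from hom_one[OF this is_group T.is_group] show ?thesis by (simp add: circle_group_def)
qed

lemma character_eq_oneI:
  assumes "\<kappa> \<in> carrier (dual_group G)" "\<And>g. g \<in> carrier G \<Longrightarrow> \<kappa> g = 1"
  shows "\<kappa> = \<one>\<^bsub>dual_group G\<^esub>"
proof (rule extensionalityI[of _ "carrier G"])
  show "\<kappa> \<in> extensional (carrier G)" "\<one>\<^bsub>dual_group G\<^esub> \<in> extensional (carrier G)"
    using assms by (auto simp: dual_group_def)
qed (use assms one_dual_apply in simp)

lemma dual_entry_closed:
  "K \<in> carrier D \<Longrightarrow> i \<in> {1..s} \<Longrightarrow> j \<in> {1..n} \<Longrightarrow> K i j \<in> carrier (dual_group G)"
  unfolding carrier_D by (auto simp: PiE_iff)

lemma one_D_closed: "\<one>\<^bsub>D\<^esub> \<in> carrier D"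
  unfolding carrier_D using one_dual_closed by (auto simp: matrix_group_def row_group_def)

lemma dual_row_eqI:
  assumes "K \<in> carrier D" "i \<in> {1..s}"
    and "\<And>j. j \<in> {1..n} \<Longrightarrow> K i j = \<one>\<^bsub>dual_group G\<^esub>"
  shows "K i = \<one>\<^bsub>row_group (dual_group G) n\<^esub>"
proof (rule extensionalityI[of _ "{1..n}"])
  show "K i \<in> extensional {1..n}"
    using assms(1,2) unfolding carrier_D by (auto simp: PiE_iff)
  show "\<one>\<^bsub>row_group (dual_group G) n\<^esub> \<in> extensional {1..n}"
    by (simp add: row_group_def)
qed (use assms(3) in \<open>simp add: row_group_def\<close>)

lemma dual_eq_oneI:
  assumes K: "K \<in> carrier D"
    and "\<And>i j. i \<in> {1..s} \<Longrightarrow> j \<in> {1..n} \<Longrightarrow> K i j = \<one>\<^bsub>dual_group G\<^esub>"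
  shows "K = \<one>\<^bsub>D\<^esub>"
proof (rule extensionalityI[of _ "{1..s}"])
  show "K \<in> extensional {1..s}" using K unfolding carrier_D by (auto simp: PiE_iff)
  show "\<one>\<^bsub>D\<^esub> \<in> extensional {1..s}" by (simp add: matrix_group_def)
  show "K i = \<one>\<^bsub>D\<^esub> i" if "i \<in> {1..s}" for i
    using dual_row_eqI[OF K that] assms(2)[OF that] that by (simp add: matrix_group_def)
qed

lemma one_mem_perp:
  assumes "P \<subseteq> carrier M"
  shows "\<one>\<^bsub>D\<^esub> \<in> perp G s n P"
proof -
  have "pairing s n \<one>\<^bsub>D\<^esub> X = 1" if "X \<in> P" for X
    unfolding pairing_def using assms that
    by (intro prod.neutral ballI) (simp add: one_D_entry one_dual_apply subsetD del: One_nat_def atLeastAtMost_iff)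
  then show ?thesis using one_D_closed by (simp add: perp_def)
qed

text \<open>\<open>K\<close> is tested on an element of \<open>P\<close> that agrees with
  \<open>single i j g\<close>. In the leading positions that element looks like
  \<open>single i j g\<close>, elsewhere \<open>K\<close> is trivial, so the pairing collapses to
  \<open>K i j g\<close>.\<close>

lemma perp_supported_eq_one:
  assumes d: "\<And>i. i \<in> {1..s} \<Longrightarrow> d i \<le> n" and P: "P \<subseteq> carrier M"
    and all: "\<forall>Y\<in>carrier M. \<exists>X\<in>P. agree d X Y"
    and K: "K \<in> perp G s n P" "supported d K"
  shows "K = \<one>\<^bsub>D\<^esub>"
proof -
  have KD: "K \<in> carrier D" using K by (simp add: perp_def)
  show ?thesis
  proof (rule dual_eq_oneI[OF KD], rule character_eq_oneI)
    fix i j assume ij: "i \<in> {1..s}" "j \<in> {1..n}"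
    show "K i j \<in> carrier (dual_group G)" using KD ij by (rule dual_entry_closed)
    fix g assume g: "g \<in> carrier G"
    obtain X where X: "X \<in> P" "agree d X (single i j g)"
      using bspec[OF all single_closed[OF g]] by blast
    have XM: "X \<in> carrier M" using X(1) P by blast
    have "K i' j' (X i' j') = (if i' = i then if j' = j then K i j g else 1 else 1)"
      if i'j': "i' \<in> {1..s}" "j' \<in> {1..n}" for i' j'
    proof (cases "d i' < j'")
      case True
      then have "K i' j' = \<one>\<^bsub>dual_group G\<^esub>" using K(2) i'j' by (simp add: supported_def)
      then show ?thesis using entry_closed[OF XM i'j'] g by (auto simp: one_dual_apply)
    next
      case False
      then have "X i' j' = single i j g i' j'" using X(2) i'j' by (simp add: agree_def)
      then show ?thesis
        using character_one[OF dual_entry_closed[OF KD i'j']] by (auto simp: single_entry[OF i'j'])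
    qed
    then have "pairing s n K X =
        (\<Prod>i'\<in>{1..s}. \<Prod>j'\<in>{1..n}. if i' = i then if j' = j then K i j g else 1 else 1)"
      unfolding pairing_def by (intro prod.cong refl)
    also have "\<dots> = (\<Prod>i'\<in>{1..s}. if i' = i then \<Prod>j'\<in>{1..n}. if j' = j then K i j g else 1 else 1)"
      by (intro prod.cong refl) simp
    also have "\<dots> = K i j g" using ij by simp
    also have "pairing s n K X = 1" using K X by (simp add: perp_def)
    finally show "K i j g = 1" by simp
  qed
qed

text \<open>This set is the product of \<open>P\<close> with the kernel of the restriction.\<close>

lemma subgroup_agree:
  assumes d: "\<And>i. i \<in> {1..s} \<Longrightarrow> d i \<le> n" and P: "subgroup P M"
  shows "subgroup {Y\<in>carrier M. \<exists>X\<in>P. agree d X Y} M"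
proof (rule M.subgroupI)
  show "{Y\<in>carrier M. \<exists>X\<in>P. agree d X Y} \<noteq> {}"
    using subgroup.one_closed[OF P] M.one_closed agree_refl by blast
next
  fix Y assume "Y \<in> {Y\<in>carrier M. \<exists>X\<in>P. agree d X Y}"
  then obtain X where X: "Y \<in> carrier M" "X \<in> P" "agree d X Y" by blast
  have "agree d (inv\<^bsub>M\<^esub> X) (inv\<^bsub>M\<^esub> Y)"
    using d X(3) subgroup.mem_carrier[OF P X(2)] X(1) by (rule agree_inv)
  then show "inv\<^bsub>M\<^esub> Y \<in> {Y\<in>carrier M. \<exists>X\<in>P. agree d X Y}"
    using M.inv_closed[OF X(1)] subgroup.m_inv_closed[OF P X(2)] by blast
next
  fix Y Z assume "Y \<in> {Y\<in>carrier M. \<exists>X\<in>P. agree d X Y}" "Z \<in> {Y\<in>carrier M. \<exists>X\<in>P. agree d X Y}"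
  then obtain X W where X: "Y \<in> carrier M" "X \<in> P" "agree d X Y"
    and W: "Z \<in> carrier M" "W \<in> P" "agree d W Z" by blast
  have "agree d (X \<otimes>\<^bsub>M\<^esub> W) (Y \<otimes>\<^bsub>M\<^esub> Z)" using d X(3) W(3) by (rule agree_mult)
  then show "Y \<otimes>\<^bsub>M\<^esub> Z \<in> {Y\<in>carrier M. \<exists>X\<in>P. agree d X Y}"
    using M.m_closed[OF X(1) W(1)] subgroup.m_closed[OF P X(2) W(2)] by blast
qed blast

text \<open>A character of \<open>M\<close> separating \<open>Y\<close> from \<open>?N\<close> is
  read off entrywise as \<open>K\<close>. Since \<open>?N\<close> contains \<open>P\<close>,
  \<open>K\<close> annihilates \<open>P\<close>; since it contains the kernel of the restriction,
  \<open>K\<close> is trivial beyond the leading positions; its value at \<open>Y\<close> makes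
  \<open>K\<close> nontrivial.\<close>

lemma exists_perp_supported:
  assumes d: "\<And>i. i \<in> {1..s} \<Longrightarrow> d i \<le> n" and P: "subgroup P M"
    and Y: "Y \<in> carrier M" "\<not> (\<exists>X\<in>P. agree d X Y)"
  shows "\<exists>K\<in>perp G s n P. supported d K \<and> K \<noteq> \<one>\<^bsub>D\<^esub>"
proof -
  interpret T: comm_group circle_group by (rule comm_group_circle_group)
  let ?N = "{Y\<in>carrier M. \<exists>X\<in>P. agree d X Y}"
  have "Y \<notin> ?N" using Y(2) by blast
  from M.exists_character_separating[OF finite_carrier_M subgroup_agree[OF d P] Y(1) this]
  obtain \<Psi> where \<Psi>: "\<Psi> \<in> hom M circle_group" "\<And>X. X \<in> ?N \<Longrightarrow> \<Psi> X = 1" "\<Psi> Y \<noteq> 1"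
    by blast
  define K where "K = (\<lambda>i\<in>{1..s}. \<lambda>j\<in>{1..n}. \<lambda>g\<in>carrier G. \<Psi> (single i j g))"
  have K_apply: "K i j g = \<Psi> (single i j g)"
    if "i \<in> {1..s}" "j \<in> {1..n}" "g \<in> carrier G" for i j g
    using that by (simp add: K_def)
  have Kc: "K i j \<in> carrier (dual_group G)" if ij: "i \<in> {1..s}" "j \<in> {1..n}" for i j
  proof -
    have "K i j \<in> hom G circle_group"
    proof (rule homI)
      show "K i j g \<in> carrier circle_group" if "g \<in> carrier G" for g
        unfolding K_apply[OF ij that] using \<Psi>(1) single_closed[OF that] by (rule hom_in_carrier)
      show "K i j (g \<otimes> h) = K i j g \<otimes>\<^bsub>circle_group\<^esub> K i j h"
        if gh: "g \<in> carrier G" "h \<in> carrier G" for g h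
        unfolding K_apply[OF ij gh(1)] K_apply[OF ij gh(2)] K_apply[OF ij m_closed[OF gh]]
          single_mult[OF gh]
        using \<Psi>(1) single_closed[OF gh(1)] single_closed[OF gh(2)] by (rule hom_mult)
    qed
    moreover have "K i j \<in> extensional (carrier G)" using ij by (simp add: K_def)
    ultimately show ?thesis by (simp add: dual_group_def)
  qed
  have KD: "K \<in> carrier D"
    unfolding carrier_D
  proof (rule PiE_I)
    show "K i \<in> {1..n} \<rightarrow>\<^sub>E carrier (dual_group G)" if "i \<in> {1..s}" for i
      using that by (intro PiE_I Kc) (auto simp: K_def)
  qed (auto simp: K_def)
  have pair: "pairing s n K X = \<Psi> X" if X: "X \<in> carrier M" for X
    unfolding pairing_def hom_matrix_decomposition[OF \<Psi>(1) X]
    by (intro prod.cong refl K_apply entry_closed[OF X])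
  have "K \<in> perp G s n P"
  proof -
    have "pairing s n K X = 1" if "X \<in> P" for X
    proof -
      have X: "X \<in> carrier M" using subgroup.mem_carrier[OF P that] .
      then have "X \<in> ?N" using that agree_refl by blast
      then show ?thesis using pair[OF X] \<Psi>(2) by simp
    qed
    then show ?thesis using KD by (simp add: perp_def)
  qed
  moreover have "supported d K"
    unfolding supported_def
  proof (intro ballI impI)
    fix i j assume ij: "i \<in> {1..s}" "j \<in> {1..n}" and dj: "d i < j"
    show "K i j = \<one>\<^bsub>dual_group G\<^esub>"
    proof (rule character_eq_oneI[OF Kc[OF ij]])
      fix g assume g: "g \<in> carrier G"
      have "agree d \<one>\<^bsub>M\<^esub> (single i j g)"
        unfolding agree_def
      proof (intro ballI)
        fix i' j' assume i': "i' \<in> {1..s}" "j' \<in> {1..d i'}"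
        then have "j' \<in> {1..n}" using d[OF i'(1)] by simp
        then show "\<one>\<^bsub>M\<^esub> i' j' = single i j g i' j'"
          using i' dj by (simp only: one_M_entry single_entry) auto
      qed
      then have "single i j g \<in> ?N"
        using single_closed[OF g] subgroup.one_closed[OF P] by blast
      then show "K i j g = 1" using \<Psi>(2) K_apply[OF ij g] by simp
    qed
  qed
  moreover have "K \<noteq> \<one>\<^bsub>D\<^esub>"
  proof
    assume K1: "K = \<one>\<^bsub>D\<^esub>"
    have "pairing s n K Y = 1"
      unfolding K1 pairing_def
      by (intro prod.neutral ballI) (simp only: one_D_entry one_dual_apply entry_closed[OF Y(1)])
    then show False using pair[OF Y(1)] \<Psi>(3) by simp
  qed
  ultimately show ?thesis by blast
qed

lemma agree_iff_perp:
  assumes d: "\<And>i. i \<in> {1..s} \<Longrightarrow> d i \<le> n" and P: "subgroup P M"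
  shows "(\<forall>Y\<in>carrier M. \<exists>X\<in>P. agree d X Y) \<longleftrightarrow>
    (\<forall>K\<in>perp G s n P. supported d K \<longrightarrow> K = \<one>\<^bsub>D\<^esub>)"
proof (intro iffI ballI impI)
  fix K assume "\<forall>Y\<in>carrier M. \<exists>X\<in>P. agree d X Y" "K \<in> perp G s n P" "supported d K"
  with d subgroup.subset[OF P] show "K = \<one>\<^bsub>D\<^esub>" by (rule perp_supported_eq_one)
next
  fix Y assume K: "\<forall>K\<in>perp G s n P. supported d K \<longrightarrow> K = \<one>\<^bsub>D\<^esub>"
    and Y: "Y \<in> carrier M"
  show "\<exists>X\<in>P. agree d X Y"
  proof (rule ccontr)
    assume "\<not> (\<exists>X\<in>P. agree d X Y)"
    with d P Y have "\<exists>K\<in>perp G s n P. supported d K \<and> K \<noteq> \<one>\<^bsub>D\<^esub>"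
      by (rule exists_perp_supported)
    then show False using K by blast
  qed
qed

section \<open>Weights\<close>

text \<open>Speaking of upper bounds only absorbs the separate value 0 at the trivial row.\<close>

lemma row_weight_le_iff:
  assumes K: "K \<in> carrier D" and i: "i \<in> {1..s}"
  shows "row_weight G n (K i) \<le> w \<longleftrightarrow>
    (\<forall>j\<in>{1..n}. w < j \<longrightarrow> K i j = \<one>\<^bsub>dual_group G\<^esub>)"
proof (cases "K i = \<one>\<^bsub>row_group (dual_group G) n\<^esub>")
  case True
  then show ?thesis by (simp add: row_weight_def) (simp add: row_group_def)
next
  case False
  then have "{j \<in> {1..n}. K i j \<noteq> \<one>\<^bsub>dual_group G\<^esub>} \<noteq> {}"
    using dual_row_eqI[OF K i] by blast
  then have "Max {j \<in> {1..n}. K i j \<noteq> \<one>\<^bsub>dual_group G\<^esub>} \<le> w \<longleftrightarrow>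
      (\<forall>j\<in>{j \<in> {1..n}. K i j \<noteq> \<one>\<^bsub>dual_group G\<^esub>}. j \<le> w)"
    by (intro Max_le_iff) auto
  also have "\<dots> \<longleftrightarrow> (\<forall>j\<in>{1..n}. w < j \<longrightarrow> K i j = \<one>\<^bsub>dual_group G\<^esub>)"
    unfolding not_le[symmetric] by blast
  finally show ?thesis using False by (simp add: row_weight_def)
qed

lemma supported_iff_row_weight:
  "K \<in> carrier D \<Longrightarrow> supported d K \<longleftrightarrow> (\<forall>i\<in>{1..s}. row_weight G n (K i) \<le> d i)"
  unfolding supported_def by (intro ball_cong refl row_weight_le_iff[symmetric])

lemma supported_imp_NRT_weight_le:
  "K \<in> carrier D \<Longrightarrow> supported d K \<Longrightarrow> NRT_weight G s n K \<le> (\<Sum>i\<in>{1..s}. d i)"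
  unfolding supported_iff_row_weight NRT_weight_def by (intro sum_mono) blast

lemma NRT_weight_le_imp_supported:
  assumes K: "K \<in> carrier D" and w: "NRT_weight G s n K \<le> w" and s: "1 \<le> s"
  shows "\<exists>d. (\<Sum>i\<in>{1..s}. d i) = w \<and> supported d K"
proof -
  \<comment> \<open>The net condition needs the total to be exactly \<open>w\<close>, so the surplus
    is put into row 1; enlarging \<open>d\<close> keeps \<open>K\<close> supported.\<close>
  define d where "d i = row_weight G n (K i) + (if i = 1 then w - NRT_weight G s n K else 0)" for i
  have "(\<Sum>i\<in>{1..s}. d i) = w"
    using w s by (simp add: d_def sum.distrib NRT_weight_def)
  moreover have "supported d K"
    using K by (simp add: supported_iff_row_weight d_def)
  ultimately show ?thesis by blast
qed

lemma NRT_weight_le: "K \<in> carrier D \<Longrightarrow> NRT_weight G s n K \<le> n * s"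
  using supported_imp_NRT_weight_le[of K "\<lambda>_. n"] by (simp add: supported_def mult.commute)

lemma NRT_weight_pos:
  assumes K: "K \<in> carrier D" and ne: "K \<noteq> \<one>\<^bsub>D\<^esub>"
  shows "0 < NRT_weight G s n K"
proof (rule ccontr)
  assume "\<not> 0 < NRT_weight G s n K"
  then have "supported (\<lambda>_. 0) K"
    using K by (simp add: supported_iff_row_weight NRT_weight_def)
  then have "K = \<one>\<^bsub>D\<^esub>" by (intro dual_eq_oneI[OF K]) (auto simp: supported_def)
  then show False using ne by blast
qed

text \<open>The cap on \<open>w\<close> matches the conventional value at the trivial subgroup,
  where the right-hand side is vacuous. Otherwise the bound \<open>n * s\<close> on weights makes
  the set under \<open>Min\<close> finite.\<close>

lemma minNRT_ge_iff:
  assumes Q: "Q \<subseteq> carrier D" "\<one>\<^bsub>D\<^esub> \<in> Q" and w: "w \<le> n * s + 1"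
  shows "w \<le> minNRT G s n Q \<longleftrightarrow> (\<forall>K\<in>Q. K \<noteq> \<one>\<^bsub>D\<^esub> \<longrightarrow> w \<le> NRT_weight G s n K)"
proof (cases "Q = {\<one>\<^bsub>D\<^esub>}")
  case True
  then show ?thesis using w by (simp add: minNRT_def)
next
  case False
  let ?W = "{NRT_weight G s n K | K. K \<in> Q \<and> K \<noteq> \<one>\<^bsub>D\<^esub>}"
  have "finite ?W"
    by (rule finite_subset[of _ "{..n * s}"]) (use Q NRT_weight_le in auto)
  moreover have "?W \<noteq> {}" using False Q by blast
  ultimately have "w \<le> Min ?W \<longleftrightarrow> (\<forall>x\<in>?W. w \<le> x)" by (rule Min_ge_iff)
  then show ?thesis using False by (auto simp: minNRT_def)
qed

section \<open>The net property and the minimum weight\<close>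

lemma comb_net_iff_minNRT:
  assumes P: "subgroup P M" "card P = b ^ m" and t: "t \<le> m" and mn: "m \<le> n" and s: "1 \<le> s"
  shows "is_comb_net \<phi> n t m s b P \<longleftrightarrow> m - t + 1 \<le> minNRT G s n (perp G s n P)"
proof -
  have perpD: "perp G s n P \<subseteq> carrier D" by (auto simp: perp_def)
  have "n * 1 \<le> n * s" using s by (rule mult_le_mono2)
  then have w: "m - t + 1 \<le> n * s + 1" using mn by linarith
  have "is_comb_net \<phi> n t m s b P \<longleftrightarrow>
     (\<forall>d. (\<Sum>i\<in>{1..s}. d i) = m - t \<longrightarrow> (\<forall>Y\<in>carrier M. \<exists>X\<in>P. agree d X Y))"
    by (rule comb_net_iff_agree[OF P t mn])
  also have "\<dots> \<longleftrightarrow> (\<forall>d. (\<Sum>i\<in>{1..s}. d i) = m - t \<longrightarrow>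
      (\<forall>K\<in>perp G s n P. supported d K \<longrightarrow> K = \<one>\<^bsub>D\<^esub>))"
  proof (intro iff_allI imp_cong refl agree_iff_perp P)
    fix d i assume "(\<Sum>i\<in>{1..s}. d i) = m - t" "i \<in> {1..s}"
    then show "d i \<le> n" using member_le_sum[of i "{1..s}" d] mn by simp
  qed
  also have "\<dots> \<longleftrightarrow> (\<forall>K\<in>perp G s n P. K \<noteq> \<one>\<^bsub>D\<^esub> \<longrightarrow> m - t + 1 \<le> NRT_weight G s n K)"
  proof
    assume L: "\<forall>d. (\<Sum>i\<in>{1..s}. d i) = m - t \<longrightarrow>
      (\<forall>K\<in>perp G s n P. supported d K \<longrightarrow> K = \<one>\<^bsub>D\<^esub>)"
    show "\<forall>K\<in>perp G s n P. K \<noteq> \<one>\<^bsub>D\<^esub> \<longrightarrow> m - t + 1 \<le> NRT_weight G s n K"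
    proof (intro ballI impI, rule ccontr)
      fix K assume K: "K \<in> perp G s n P" "K \<noteq> \<one>\<^bsub>D\<^esub>" "\<not> m - t + 1 \<le> NRT_weight G s n K"
      then have "NRT_weight G s n K \<le> m - t" by simp
      from NRT_weight_le_imp_supported[OF subsetD[OF perpD K(1)] this s]
      show False using L K by blast
    qed
  next
    assume R: "\<forall>K\<in>perp G s n P. K \<noteq> \<one>\<^bsub>D\<^esub> \<longrightarrow> m - t + 1 \<le> NRT_weight G s n K"
    show "\<forall>d. (\<Sum>i\<in>{1..s}. d i) = m - t \<longrightarrow>
      (\<forall>K\<in>perp G s n P. supported d K \<longrightarrow> K = \<one>\<^bsub>D\<^esub>)"
    proof (intro allI impI ballI, rule ccontr)
      fix d K assume d: "(\<Sum>i\<in>{1..s}. d i) = m - t" and K: "K \<in> perp G s n P"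
        and "supported d K" "K \<noteq> \<one>\<^bsub>D\<^esub>"
      then have "NRT_weight G s n K \<le> m - t" "m - t + 1 \<le> NRT_weight G s n K"
        using supported_imp_NRT_weight_le[OF subsetD[OF perpD K]] R by fastforce+
      then show False by simp
    qed
  qed
  also have "\<dots> \<longleftrightarrow> m - t + 1 \<le> minNRT G s n (perp G s n P)"
    using minNRT_ge_iff[OF perpD one_mem_perp[OF subgroup.subset[OF P(1)]] w] by simp
  finally show ?thesis .
qed

text \<open>
  If every nontrivial character in the annihilator had weight above \<open>m + 1\<close>, then \<open>P\<close> would
  take all values on some \<open>m + 1\<close> leading positions, which its cardinality forbids.
\<close>

lemma minNRT_perp_le:
  assumes P: "subgroup P M" "card P = b ^ m" and mn: "m \<le> n" "1 \<le> m" and s: "1 \<le> s"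
  shows "minNRT G s n (perp G s n P) \<le> m + 1"
proof (rule ccontr)
  assume contr: "\<not> minNRT G s n (perp G s n P) \<le> m + 1"
  have perpD: "perp G s n P \<subseteq> carrier D" by (auto simp: perp_def)
  note ge_iff = minNRT_ge_iff[OF perpD one_mem_perp[OF subgroup.subset[OF P(1)]]]
  have bound: "(\<Sum>i\<in>{1..s}. d i) \<le> m"
    if d: "\<And>i. i \<in> {1..s} \<Longrightarrow> d i \<le> n" and sd: "(\<Sum>i\<in>{1..s}. d i) \<le> m + 1" for d
  proof -
    have "\<forall>K\<in>perp G s n P. supported d K \<longrightarrow> K = \<one>\<^bsub>D\<^esub>"
    proof (intro ballI impI, rule ccontr)
      fix K assume K: "K \<in> perp G s n P" "supported d K" "K \<noteq> \<one>\<^bsub>D\<^esub>"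
      \<comment> \<open>This keeps the total plus 1 below the cap \<open>n * s + 1\<close> required
        by \<open>ge_iff\<close>.\<close>
      have "(\<Sum>i\<in>{1..s}. d i) \<le> (\<Sum>i\<in>{1..s}. n)" using d by (rule sum_mono)
      then have "(\<Sum>i\<in>{1..s}. d i) + 1 \<le> NRT_weight G s n K"
        using ge_iff[of "(\<Sum>i\<in>{1..s}. d i) + 1"] contr sd K by (simp add: mult.commute)
      then show False
        using supported_imp_NRT_weight_le[OF subsetD[OF perpD K(1)] K(2)] by simp
    qed
    then have "\<forall>Y\<in>carrier M. \<exists>X\<in>P. agree d X Y"
      using agree_iff_perp[of d, OF d P(1)] by blast
    then show ?thesis
      using agree_imp_sum_le[of d P m, OF d subgroup.subset[OF P(1)] P(2)] by blast
  qed
  \<comment> \<open>With more than \<open>m\<close> positions there is room for a shape of total m +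
    1, contradicting \<open>bound\<close>.\<close>
  have "n * s \<le> m"
  proof (rule ccontr)
    assume ns: "\<not> n * s \<le> m"
    show False
    proof (cases "m < n")
      case True
      let ?d = "\<lambda>i. if i = 1 then m + 1 else 0"
      have le: "?d i \<le> n" for i :: nat using True by simp
      have sum: "(\<Sum>i\<in>{1..s}. ?d i) = m + 1" using s by simp
      have "(\<Sum>i\<in>{1..s}. ?d i) \<le> m"
        by (rule bound[OF le]) (simp only: sum le_refl)
      then show False unfolding sum by simp
    next
      case False
      then have "n = m" using mn by simp
      then have "s \<noteq> 1" using ns by auto
      then have "2 \<le> s" using s by simp
      \<comment> \<open>Row 1 is full with m = n columns, so the extra position goes to row 2, whose
        first column exists because \<open>1 \<le> m\<close>.\<close>
      let ?d = "\<lambda>i. (if i = 1 then m else 0) + (if i = 2 then 1 else 0)"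
      have le: "?d i \<le> n" for i :: nat using mn by simp
      have sum: "(\<Sum>i\<in>{1..s}. ?d i) = m + 1"
        using \<open>2 \<le> s\<close> by (simp add: sum.distrib)
      have "(\<Sum>i\<in>{1..s}. ?d i) \<le> m"
        by (rule bound[OF le]) (simp only: sum le_refl)
      then show False unfolding sum by simp
    qed
  qed
  \<comment> \<open>Now n*s + 1 is at most m + 1, but the assumed minimum exceeds m + 1: too large
    for the conventional value and for any actual weight.\<close>
  show False
  proof (cases "perp G s n P = {\<one>\<^bsub>D\<^esub>}")
    case True
    then show False using contr \<open>n * s \<le> m\<close> by (simp add: minNRT_def)
  next
    case False
    then obtain K where K: "K \<in> perp G s n P" "K \<noteq> \<one>\<^bsub>D\<^esub>"
      using one_mem_perp[OF subgroup.subset[OF P(1)]] by blast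
    have "n * s + 1 \<le> NRT_weight G s n K"
      using ge_iff[of "n * s + 1"] K contr \<open>n * s \<le> m\<close> by simp
    then show False using NRT_weight_le[OF subsetD[OF perpD K(1)]] by simp
  qed
qed

end

theorem theorem1:
  fixes G :: "('a, 'c) monoid_scheme"
    and \<phi> :: "nat \<Rightarrow> 'a"
    and b s m n :: nat
    and P :: "(nat \<Rightarrow> nat \<Rightarrow> 'a) set"
  assumes "comm_group G"
    and "finite (carrier G)"
    and "order G = b"
    and "b \<ge> 2"
    and "bij_betw \<phi> {0..<b} (carrier G)"
    and "\<phi> 0 = \<one>\<^bsub>G\<^esub>"
    and "s \<ge> 1"
    and "m \<ge> 1"
    and "n \<ge> m"
    and "subgroup P (matrix_group G s n)"
    and "card P = b ^ m"
  shows "(\<forall>t\<le>m. is_comb_net \<phi> n t m s b P \<longleftrightarrow> minNRT G s n (perp G s n P) \<ge> m - t + 1) \<and>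
         (\<exists>t. int t = int m + 1 - int (minNRT G s n (perp G s n P)) \<and>
              is_strict_comb_net \<phi> n t m s b P)"
proof -
  interpret matrix_code G \<phi> b s n
    by (intro matrix_code.intro matrix_code_axioms.intro assms)
  let ?w = "minNRT G s n (perp G s n P)"
  have net: "is_comb_net \<phi> n t m s b P \<longleftrightarrow> m - t + 1 \<le> ?w" if "t \<le> m" for t
    using comb_net_iff_minNRT[OF assms(10,11) that assms(9,7)] .
  \<comment> \<open>This makes \<open>m + 1 - ?w\<close> a genuine difference rather than a
    truncated one.\<close>
  have le: "?w \<le> m + 1"
    using minNRT_perp_le[OF assms(10,11,9,8,7)] .
  \<comment> \<open>This gives m + 1 - ?w \<le> m, so that \<open>net\<close> applies at the claimed
    t-value.\<close>
  have "1 \<le> ?w"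
  proof -
    have D: "perp G s n P \<subseteq> carrier D" by (auto simp: perp_def)
    have "\<forall>K\<in>perp G s n P. K \<noteq> \<one>\<^bsub>D\<^esub> \<longrightarrow> 1 \<le> NRT_weight G s n K"
      using NRT_weight_pos D by (auto simp: Suc_le_eq)
    then show ?thesis
      using minNRT_ge_iff[OF D one_mem_perp[OF subgroup.subset[OF assms(10)]], of 1] by simp
  qed
  then have "is_strict_comb_net \<phi> n (m + 1 - ?w) m s b P"
    using net le by (auto simp: is_strict_comb_net_def)
  moreover have "int (m + 1 - ?w) = int m + 1 - int ?w" using le by (simp add: of_nat_diff)
  ultimately show ?thesis using net by blast
qed

end
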